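(* Let $G$ be a $\sigma$-compact, locally compact, amenable group acting continuously on a compact metric space $X$, and let $(F_n)_{n\ge1}$ be a Følner sequence in $G$. For $\phi:X\to\mathbb{C}$ put $A_n\phi(x)=\frac{1}{m_G(F_n)}\int_{F_n}\phi(g\cdot x)\,dm_G(g)$. Then the following are equivalent: (1) for all $\phi\in C(X)$ and all $x\in X$, the limit $\lim_{n\to\infty}A_n\phi(x)$ exists and is independent of $x$; (2) the limit in (1) exists, is independent of $x$, and is uniform in $x$, for every $\phi\in C(X)$; (3) $C(X)=\mathbb{C}\oplus\overline{\mathrm{Span}(\mathcal{B})}$ (direct sum), where $\mathbb{C}$ denotes the constant functions; (4) the action of $G$ on $X$ is uniquely ergodic; (5) there is a $G$-invariant Borel probability measure $\mu$ on $X$ such that the conclusion of (1) holds for all Riemann integrable functions: for every $\mu$-Riemann integrable function $\phi$ and all $x\in X$, $\lim_{n\to\infty}A_n\phi(x)$ exists and is independent of $x$.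
   Context: $m_G$ is a (left) Haar measure on $G$; $G$ need not be Abelian. A continuous action is given by $(g,x)\mapsto g\cdot x$ continuous on $G\times X$ with $g'\cdot(g\cdot x)=(g'g)\cdot x$, each $x\mapsto g\cdot x$ being a homeomorphism. $G$ is amenable if for every compact $K\subset G$ and every $\varepsilon>0$ there is a measurable set $F\subset G$ with compact closure such that $KF=\{kf:k\in K,f\in F\}$ is measurable and $m_G(F\,\Delta\,KF)\le\varepsilon\, m_G(F)$; such an $F$ is called $(K,\varepsilon)$-invariant. A Følner sequence is a sequence $(F_n)_{n\ge1}$ of compact subsets of $G$ (with $m_G(F_n)>0$) such that for every compact $K\subset G$ and every $\varepsilon>0$ all but finitely many $F_n$ are $(K,\varepsilon)$-invariant. $C(X)$ is the Banach space of continuous complex-valued functions on $X$ with the supremum norm. For $g\in G$, $T_g:C(X)\to C(X)$ is $T_g\phi(x)=\phi(g\cdot x)$, and $\mathcal{B}=\bigcup_{g\in G}\mathrm{Im}(T_g-I)$ with $I$ the identity operator; $\mathrm{Span}(\mathcal{B})$ is the linear span of $\mathcal{B}$ and the bar denotes closure in $C(X)$. The action is uniquely ergodic if there is exactly one $G$-invariant Borel probability measure on $X$. A function on $X$ is $\mu$-Riemann integrable if it is a uniform limit of finite sums $\sum_k a_k 1_{A_k}$ where each $A_k\subset X$ is a Borel set whose topological boundary has $\mu$-measure zero. *)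

theory Defs
  imports "HOL-Probability.Probability"
begin

text \<open>
  The group \<open>G\<close> is a type \<open>'g\<close> of class \<^class>\<open>topological_group_add\<close>.  This class is written
  additively but is not commutative: \<open>g + h\<close> is the product \<open>gh\<close> and \<open>0\<close> the identity.
\<close>

definition sigma_compact :: "'a::topological_space set \<Rightarrow> bool" where
  "sigma_compact S \<longleftrightarrow> (\<exists>C :: nat \<Rightarrow> 'a set. (\<forall>n. compact (C n)) \<and> S = (\<Union>n. C n))"

text \<open>
  A left Haar measure is a nonzero left-invariant Radon measure on the Borel sets.
\<close>

definition left_haar_measure :: "'g::{topological_group_add, t2_space} measure \<Rightarrow> bool" where
  "left_haar_measure m \<longleftrightarrow>
     sets m = sets borel \<and>
     emeasure m UNIV \<noteq> 0 \<and>
     (\<forall>g. \<forall>A\<in>sets borel. emeasure m ((+) g ` A) = emeasure m A) \<and>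
     (\<forall>K. compact K \<longrightarrow> emeasure m K < \<infinity>) \<and>
     (\<forall>A\<in>sets borel. emeasure m A = (INF U\<in>{U. open U \<and> A \<subseteq> U}. emeasure m U)) \<and>
     (\<forall>U. open U \<longrightarrow> emeasure m U = (SUP K\<in>{K. compact K \<and> K \<subseteq> U}. emeasure m K))"

definition set_product :: "'g::group_add set \<Rightarrow> 'g set \<Rightarrow> 'g set" where
  "set_product K F = {k + f | k f. k \<in> K \<and> f \<in> F}"

definition almost_invariant ::
    "'g::{topological_group_add, t2_space} measure \<Rightarrow> 'g set \<Rightarrow> real \<Rightarrow> 'g set \<Rightarrow> bool" where
  "almost_invariant m K \<epsilon> F \<longleftrightarrow>
     F \<in> sets m \<and> compact (closure F) \<and> set_product K F \<in> sets m \<and>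
     emeasure m (sym_diff F (set_product K F)) \<le> ennreal \<epsilon> * emeasure m F"

text \<open>
  Two degenerate cases are excluded.  The set \<open>K\<close> is nonempty, since \<open>K = {}\<close> gives
  \<open>KF = {}\<close> and then no set of positive measure is \<open>(K, \<epsilon>)\<close>-invariant for \<open>\<epsilon> < 1\<close>.  The set
  \<open>F\<close> in the definition of amenability has positive measure, since \<open>F = {}\<close> would otherwise
  always qualify.
\<close>

definition amenable :: "'g::{topological_group_add, t2_space} measure \<Rightarrow> bool" where
  "amenable m \<longleftrightarrow>
     (\<forall>K \<epsilon>. compact K \<and> K \<noteq> {} \<and> \<epsilon> > 0 \<longrightarrow>
        (\<exists>F. emeasure m F > 0 \<and> almost_invariant m K \<epsilon> F))"

definition folner_sequence ::
    "'g::{topological_group_add, t2_space} measure \<Rightarrow> (nat \<Rightarrow> 'g set) \<Rightarrow> bool" where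
  "folner_sequence m F \<longleftrightarrow>
     (\<forall>n. compact (F n) \<and> emeasure m (F n) > 0) \<and>
     (\<forall>K \<epsilon>. compact K \<and> K \<noteq> {} \<and> \<epsilon> > 0 \<longrightarrow>
        (\<forall>\<^sub>F n in sequentially. almost_invariant m K \<epsilon> (F n)))"

definition continuous_action ::
    "('g::topological_group_add \<Rightarrow> 'x::topological_space \<Rightarrow> 'x) \<Rightarrow> bool" where
  "continuous_action act \<longleftrightarrow>
     continuous_on UNIV (\<lambda>(g, x). act g x) \<and>
     (\<forall>g' g x. act g' (act g x) = act (g' + g) x) \<and>
     (\<forall>g. \<exists>h. homeomorphism UNIV UNIV (act g) h)"

definition ergodic_average ::
    "('g::topological_space \<Rightarrow> 'x \<Rightarrow> 'x) \<Rightarrow> 'g measure \<Rightarrow> (nat \<Rightarrow> 'g set) \<Rightarrow>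
     nat \<Rightarrow> ('x \<Rightarrow> complex) \<Rightarrow> 'x \<Rightarrow> complex" where
  "ergodic_average act m F n \<phi> x =
     (1 / complex_of_real (measure m (F n))) * (LINT g:F n|m. \<phi> (act g x))"

text \<open>
  For a compact space \<open>'x\<close>, the Banach space \<open>C(X)\<close> is the library type \<open>'x \<Rightarrow>\<^sub>C complex\<close>
  with the supremum norm.  The library has it only as a real vector space, so the complex
  scalar multiplication and the complex span are supplied here.
\<close>

lemma bcontfun_iff_continuous:
  fixes f :: "'x::metric_space \<Rightarrow> complex"
  assumes "compact (UNIV :: 'x set)"
  shows "f \<in> bcontfun \<longleftrightarrow> continuous_on UNIV f"
  using assms by (auto simp: bcontfun_def intro: compact_imp_bounded compact_continuous_image)

definition scale_bcontfun ::
    "complex \<Rightarrow> ('x::topological_space \<Rightarrow>\<^sub>C complex) \<Rightarrow> ('x \<Rightarrow>\<^sub>C complex)" where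
  "scale_bcontfun c f = Bcontfun (\<lambda>x. c * apply_bcontfun f x)"

lemma apply_scale_bcontfun [simp]:
  "apply_bcontfun (scale_bcontfun c f) x = c * apply_bcontfun f x"
proof -
  have "bounded ((*) c ` range (apply_bcontfun f))"
    by (intro bounded_linear_image bounded_apply_bcontfun bounded_linear_mult_right)
  then have "(\<lambda>x. c * apply_bcontfun f x) \<in> bcontfun"
    by (auto simp: bcontfun_def image_image intro!: continuous_intros)
  then show ?thesis
    by (simp add: scale_bcontfun_def Bcontfun_inverse)
qed

lemma vector_space_scale_bcontfun: "vector_space scale_bcontfun"
  by (unfold_locales; rule bcontfun_eqI; simp add: algebra_simps)

definition cspan :: "('x::topological_space \<Rightarrow>\<^sub>C complex) set \<Rightarrow> ('x \<Rightarrow>\<^sub>C complex) set" where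
  "cspan = module.span scale_bcontfun"

definition koopman ::
    "('g \<Rightarrow> 'x \<Rightarrow> 'x) \<Rightarrow> 'g \<Rightarrow> ('x::topological_space \<Rightarrow>\<^sub>C complex) \<Rightarrow> ('x \<Rightarrow>\<^sub>C complex)" where
  "koopman act g \<phi> = Bcontfun (\<lambda>x. apply_bcontfun \<phi> (act g x))"

lemma apply_koopman:
  assumes "continuous_action act"
  shows "apply_bcontfun (koopman act g \<phi>) x = apply_bcontfun \<phi> (act g x)"
proof -
  have "continuous_on UNIV (act g)"
    using assms by (auto simp: continuous_action_def homeomorphism_def)
  then have "continuous_on UNIV (\<lambda>x. apply_bcontfun \<phi> (act g x))"
    by (rule continuous_on_compose2[OF continuous_on_apply_bcontfun]) auto
  moreover have "bounded (range (\<lambda>x. apply_bcontfun \<phi> (act g x)))"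
    by (rule bounded_subset[OF bounded_apply_bcontfun[of \<phi>]]) auto
  ultimately show ?thesis
    by (simp add: koopman_def Bcontfun_inverse bcontfun_def)
qed

definition coboundaries ::
    "('g \<Rightarrow> 'x \<Rightarrow> 'x) \<Rightarrow> ('x::topological_space \<Rightarrow>\<^sub>C complex) set" where
  "coboundaries act = (\<Union>g. range (\<lambda>\<phi>. koopman act g \<phi> - \<phi>))"

definition is_direct_sum :: "'v::ab_group_add set \<Rightarrow> 'v set \<Rightarrow> bool" where
  "is_direct_sum U V \<longleftrightarrow> {u + v | u v. u \<in> U \<and> v \<in> V} = UNIV \<and> U \<inter> V = {0}"

definition invariant_probability ::
    "('g \<Rightarrow> 'x \<Rightarrow> 'x) \<Rightarrow> 'x::topological_space measure \<Rightarrow> bool" where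
  "invariant_probability act \<mu> \<longleftrightarrow>
     sets \<mu> = sets borel \<and> prob_space \<mu> \<and> (\<forall>g. distr \<mu> borel (act g) = \<mu>)"

definition uniquely_ergodic :: "('g \<Rightarrow> 'x \<Rightarrow> 'x::topological_space) \<Rightarrow> bool" where
  "uniquely_ergodic act \<longleftrightarrow> (\<exists>!\<mu>. invariant_probability act \<mu>)"

definition jordan_simple :: "'x::topological_space measure \<Rightarrow> ('x \<Rightarrow> complex) \<Rightarrow> bool" where
  "jordan_simple \<mu> s \<longleftrightarrow>
     (\<exists>(N::nat) (a :: nat \<Rightarrow> complex) (A :: nat \<Rightarrow> 'x set).
        (\<forall>k<N. A k \<in> sets borel \<and> emeasure \<mu> (frontier (A k)) = 0) \<and>
        s = (\<lambda>x. \<Sum>k<N. a k * indicator (A k) x))"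

definition riemann_integrable :: "'x::topological_space measure \<Rightarrow> ('x \<Rightarrow> complex) \<Rightarrow> bool" where
  "riemann_integrable \<mu> \<phi> \<longleftrightarrow>
     (\<exists>s :: nat \<Rightarrow> 'x \<Rightarrow> complex.
        (\<forall>n. jordan_simple \<mu> (s n)) \<and> uniform_limit UNIV s \<phi> sequentially)"

text \<open>
  The limit exists at every point and is independent of the point; respectively, it is in
  addition uniform.
\<close>

definition averages_converge ::
    "('g::topological_space \<Rightarrow> 'x \<Rightarrow> 'x) \<Rightarrow> 'g measure \<Rightarrow> (nat \<Rightarrow> 'g set) \<Rightarrow>
     ('x \<Rightarrow> complex) \<Rightarrow> bool" where
  "averages_converge act m F \<phi> \<longleftrightarrow>
     (\<exists>c. \<forall>x. (\<lambda>n. ergodic_average act m F n \<phi> x) \<longlonglongrightarrow> c)"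

definition averages_converge_uniformly ::
    "('g::topological_space \<Rightarrow> 'x \<Rightarrow> 'x) \<Rightarrow> 'g measure \<Rightarrow> (nat \<Rightarrow> 'g set) \<Rightarrow>
     ('x \<Rightarrow> complex) \<Rightarrow> bool" where
  "averages_converge_uniformly act m F \<phi> \<longleftrightarrow>
     (\<exists>c. uniform_limit UNIV (\<lambda>n x. ergodic_average act m F n \<phi> x) (\<lambda>x. c) sequentially)"

definition all_equivalent :: "bool list \<Rightarrow> bool" where
  "all_equivalent Ps \<longleftrightarrow> (\<forall>P\<in>set Ps. \<forall>Q\<in>set Ps. P \<longleftrightarrow> Q)"

end

theory Submission
  imports Defs
begin

text \<open>
  Write \<open>A\<^sub>n \<phi> x\<close> for the ergodic average.  It is the integral of \<open>\<phi>\<close> against a Borel probability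
  measure, the orbit measure at \<open>x\<close>, which is the distribution of \<open>g \<cdot> x\<close> for \<open>g\<close> uniform in \<open>F\<^sub>n\<close>.
  Three facts carry the proof.

  The first is that the averages of a coboundary \<open>T\<^sub>g \<phi> - \<phi>\<close> tend to \<open>0\<close> uniformly, because \<open>F\<^sub>n\<close> is
  almost invariant under the left translation by \<open>g\<close>.  The same follows for the closed span
  (\<open>averages_closure_coboundaries\<close>).  The second is a converse: \<open>\<phi> - A\<^sub>n \<phi>\<close> lies in the closed span,
  since \<open>A\<^sub>n \<phi>\<close> is a uniform limit of convex combinations of the \<open>T\<^sub>g \<phi>\<close>
  (\<open>average_approx_coboundary\<close>).  Together they say that uniform convergence to constants is the
  decomposition of \<open>C(X)\<close> into constants and the closed span.  As an invariant measure vanishes on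
  coboundaries, the second fact also shows that it gives \<open>\<phi>\<close> and \<open>A\<^sub>n \<phi>\<close> the same integral; if the
  averages converge pointwise to a constant, dominated convergence identifies that constant with the
  integral of \<open>\<phi>\<close>, so there is at most one invariant measure (\<open>integral_eq_limit_average\<close>).

  The third is compactness: along a suitable filter the orbit measures, at base points that may
  depend on \<open>n\<close>, converge weakly to an invariant probability measure (\<open>invariant_cluster_point\<close>).
  This gives existence of an invariant measure.  If that measure is unique, averages that failed to
  converge uniformly to the integral would produce a second one (\<open>uniquely_ergodic_uniform_limit\<close>).
  Weak compactness of probability measures on \<open>X\<close> is obtained from Tychonoff's theorem and from the
  Riesz representation theorem for compact metric spaces, which is proved by the Caratheodory
  construction.

  Finally, weak convergence to \<open>\<mu>\<close> passes to sets with \<open>\<mu>\<close>-null boundary by the portmanteau theorem,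
  and from there to Riemann integrable functions.  Conversely every continuous function is Riemann
  integrable for every finite Borel measure (\<open>continuous_riemann_integrable\<close>), since \<open>X\<close> has finite
  partitions into arbitrarily small sets with null boundary.
\<close>

section \<open>Continuous approximation of closed sets\<close>

text \<open>
  The continuous functions \<open>hat C n\<close> decrease to the indicator of the closed set \<open>C\<close>.  The case
  \<open>C = {}\<close> is separate because \<open>infdist x {} = 0\<close>.
\<close>

definition hat :: "'x::metric_space set \<Rightarrow> nat \<Rightarrow> 'x \<Rightarrow> real" where
  "hat C n x = (if C = {} then 0 else max 0 (1 - real n * infdist x C))"

lemma continuous_on_hat [continuous_intros]: "continuous_on S (hat C n)"
proof (cases "C = {}")
  case False
  have "continuous_on S (\<lambda>x. max 0 (1 - real n * infdist x C))"
    by (intro continuous_intros)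
  then show ?thesis
    using False by (simp add: hat_def[abs_def])
qed (simp add: hat_def[abs_def])

lemma hat_nonneg: "0 \<le> hat C n x"
  and hat_le_1: "hat C n x \<le> 1"
  by (auto simp: hat_def infdist_nonneg)

lemma hat_eq_1: "x \<in> C \<Longrightarrow> hat C n x = 1"
  by (auto simp: hat_def)

lemma indicator_le_hat: "indicator C x \<le> hat C n x"
  by (auto simp: indicator_def hat_eq_1 hat_nonneg)

lemma hat_antimono: "k \<le> n \<Longrightarrow> hat C n x \<le> hat C k x"
proof -
  assume "k \<le> n"
  then have "real k * infdist x C \<le> real n * infdist x C"
    by (intro mult_right_mono) (auto simp: infdist_nonneg)
  then show ?thesis by (auto simp: hat_def)
qed

lemma eventually_hat_eq_0:
  assumes "closed C" "x \<notin> C"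
  shows "\<forall>\<^sub>F n in sequentially. hat C n x = 0"
proof (cases "C = {}")
  case False
  then have "0 < infdist x C"
    using assms by (metis infdist_nonneg in_closed_iff_infdist_zero order_le_less)
  then obtain k :: nat where k: "1 < real k * infdist x C"
    using reals_Archimedean3 by blast
  have "hat C n x = 0" if "k \<le> n" for n
  proof -
    have "real k * infdist x C \<le> real n * infdist x C"
      using that by (intro mult_right_mono) (auto simp: infdist_nonneg)
    then show ?thesis using k by (simp add: hat_def)
  qed
  then show ?thesis
    by (auto simp: eventually_sequentially)
qed (simp add: hat_def)

lemma hat_tendsto_indicator:
  assumes "closed C"
  shows "(\<lambda>n. hat C n x) \<longlonglongrightarrow> indicator C x"
proof (cases "x \<in> C")
  case False
  then show ?thesis
    using eventually_hat_eq_0[OF assms False] by (simp add: tendsto_eventually)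
qed (simp add: hat_eq_1)

lemma hat_borel [measurable]: "hat C n \<in> borel_measurable borel"
  by (intro borel_measurable_continuous_onI continuous_on_hat)

lemma integral_hat_tendsto:
  assumes "finite_measure M" "sets M = sets borel" "closed C"
  shows "(\<lambda>n. LINT x|M. hat C n x) \<longlonglongrightarrow> measure M C"
proof -
  interpret finite_measure M by fact
  have [measurable]: "hat C n \<in> borel_measurable M" for n
    by (subst measurable_cong_sets[OF assms(2) refl]) (rule hat_borel)
  have [measurable]: "C \<in> sets M" using assms by auto
  have "(\<lambda>n. LINT x|M. hat C n x) \<longlonglongrightarrow> (LINT x|M. indicator C x)"
    by (rule integral_dominated_convergence[where w = "\<lambda>_. 1"])
      (auto intro!: hat_tendsto_indicator assms simp: hat_nonneg hat_le_1)
  then show ?thesis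
    using sets.sets_into_space[OF \<open>C \<in> sets M\<close>] by (simp add: Int_absorb2)
qed

section \<open>Borel measures on a metric space and continuous functions\<close>

lemma borel_measure_eqI_continuous:
  fixes \<mu> \<nu> :: "'x::metric_space measure"
  assumes "finite_measure \<mu>" "finite_measure \<nu>" "sets \<mu> = sets borel" "sets \<nu> = sets borel"
    and eq: "\<And>f :: 'x \<Rightarrow> real. continuous_on UNIV f \<Longrightarrow> bounded (range f) \<Longrightarrow>
      (LINT x|\<mu>. f x) = (LINT x|\<nu>. f x)"
  shows "\<mu> = \<nu>"
proof -
  interpret \<mu>: finite_measure \<mu> by fact
  interpret \<nu>: finite_measure \<nu> by fact
  have eqc: "emeasure \<mu> C = emeasure \<nu> C" if "closed C" for C
  proof -
    have "bounded (range (hat C n))" for n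
      by (rule boundedI[where B = 1]) (auto simp: hat_nonneg hat_le_1)
    then have "(LINT x|\<mu>. hat C n x) = (LINT x|\<nu>. hat C n x)" for n
      by (intro eq continuous_on_hat)
    then have "measure \<mu> C = measure \<nu> C"
      using integral_hat_tendsto[OF assms(1,3) that] integral_hat_tendsto[OF assms(2,4) that]
      by (auto intro: LIMSEQ_unique)
    then show ?thesis
      by (simp add: \<mu>.emeasure_eq_measure \<nu>.emeasure_eq_measure)
  qed
  show ?thesis
    by (rule measure_eqI_generator_eq[where E = "Collect closed" and \<Omega> = UNIV and A = "\<lambda>_. UNIV"])
      (use assms eqc in \<open>auto simp: Int_stable_def borel_eq_closed\<close>)
qed

text \<open>
  The part of the portmanteau theorem needed here, along an arbitrary filter.  An upper bound for
  \<open>\<nu> i A\<close> comes from approximating the closure of \<open>A\<close> by \<open>hat\<close> functions; the lower bound is the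
  upper bound for the complement.
\<close>

lemma portmanteau_null_frontier:
  fixes \<nu> :: "'i \<Rightarrow> 'x::metric_space measure"
  assumes prob: "\<And>i. prob_space (\<nu> i)" "\<And>i. sets (\<nu> i) = sets borel"
    and \<mu>: "prob_space \<mu>" "sets \<mu> = sets borel"
    and lim: "\<And>f :: 'x \<Rightarrow> real. continuous_on UNIV f \<Longrightarrow> bounded (range f) \<Longrightarrow>
      ((\<lambda>i. LINT x|\<nu> i. f x) \<longlongrightarrow> (LINT x|\<mu>. f x)) G"
    and A: "A \<in> sets borel" "emeasure \<mu> (frontier A) = 0"
  shows "((\<lambda>i. measure (\<nu> i) A) \<longlongrightarrow> measure \<mu> A) G"
proof -
  interpret \<mu>: prob_space \<mu> by fact
  have closed_bound: "\<forall>\<^sub>F i in G. measure (\<nu> i) C < measure \<mu> C + e" if C: "closed C" and "e > 0" for C e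
  proof -
    have "\<forall>\<^sub>F n in sequentially. (LINT x|\<mu>. hat C n x) < measure \<mu> C + e"
      by (rule order_tendstoD[OF integral_hat_tendsto]) (use C \<mu> \<open>e > 0\<close> \<mu>.finite_measure in auto)
    then obtain n where n: "(LINT x|\<mu>. hat C n x) < measure \<mu> C + e"
      by (auto simp: eventually_sequentially)
    have "bounded (range (hat C n))"
      by (rule boundedI[where B = 1]) (auto simp: hat_nonneg hat_le_1)
    from order_tendstoD(2)[OF lim[OF continuous_on_hat this] n]
    show ?thesis
    proof eventually_elim
      case (elim i)
      interpret prob_space "\<nu> i" by fact
      have [measurable]: "hat C n \<in> borel_measurable (\<nu> i)"
        by (subst measurable_cong_sets[OF prob(2) refl]) (rule hat_borel)
      have [measurable]: "C \<in> sets (\<nu> i)" using prob C by auto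
      have "measure (\<nu> i) C = (LINT x|\<nu> i. indicator C x)"
        using sets.sets_into_space[OF \<open>C \<in> sets (\<nu> i)\<close>] by (simp add: Int_absorb2)
      also have "\<dots> \<le> (LINT x|\<nu> i. hat C n x)"
        by (intro integral_mono integrable_const_bound[where B = 1])
          (auto simp: hat_nonneg hat_le_1 indicator_le_hat)
      finally show ?case using elim by simp
    qed
  qed
  have space: "space \<mu> = UNIV" "\<And>i. space (\<nu> i) = UNIV"
    using sets_eq_imp_space_eq[OF \<mu>(2)] sets_eq_imp_space_eq[OF prob(2)] by auto
  have bound: "\<forall>\<^sub>F i in G. measure (\<nu> i) B < measure \<mu> B + e"
    if B: "B \<in> sets borel" "emeasure \<mu> (frontier B) = 0" and "e > 0" for B e
  proof -
    have "closure B \<subseteq> B \<union> frontier B"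
      by (simp add: closure_Un_frontier)
    then have "measure \<mu> (closure B) \<le> measure \<mu> (B \<union> frontier B)"
      using B \<mu> by (intro \<mu>.finite_measure_mono) simp_all
    also have "\<dots> \<le> measure \<mu> B + measure \<mu> (frontier B)"
      using B \<mu> by (intro measure_Un_le) auto
    also have "measure \<mu> (frontier B) = 0"
      using B by (simp add: measure_def)
    finally have le: "measure \<mu> (closure B) \<le> measure \<mu> B" by simp
    show ?thesis
      using closed_bound[OF closed_closure \<open>e > 0\<close>, of B]
    proof eventually_elim
      case (elim i)
      interpret prob_space "\<nu> i" by fact
      have "measure (\<nu> i) B \<le> measure (\<nu> i) (closure B)"
        using prob by (intro finite_measure_mono closure_subset) simp
      then show ?case using elim le by simp
    qed
  qed
  show ?thesis
  proof (rule tendstoI)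
    fix e :: real assume "e > 0"
    have "-A \<in> sets borel" "emeasure \<mu> (frontier (-A)) = 0"
      using A by auto
    from bound[OF A \<open>e > 0\<close>] bound[OF this \<open>e > 0\<close>]
    show "\<forall>\<^sub>F i in G. dist (measure (\<nu> i) A) (measure \<mu> A) < e"
    proof eventually_elim
      case (elim i)
      interpret prob_space "\<nu> i" by fact
      have "measure (\<nu> i) (-A) = 1 - measure (\<nu> i) A" "measure \<mu> (-A) = 1 - measure \<mu> A"
        using prob_compl[of A] \<mu>.prob_compl[of A] A prob \<mu> space by (auto simp: Compl_eq_Diff_UNIV)
      then show ?case using elim by (auto simp: dist_real_def)
    qed
  qed
qed

section \<open>The Riesz representation theorem on a compact metric space\<close>

lemma sum_clamp:
  assumes "0 \<le> t" "t \<le> real N"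
  shows "(\<Sum>k<N. min 1 (max 0 (t - real k))) = t"
  using assms
proof (induction N arbitrary: t)
  case (Suc N)
  show ?case
  proof (cases "t \<le> real N")
    case True
    then show ?thesis using Suc by simp
  next
    case False
    then have "(\<Sum>k<N. min 1 (max 0 (t - real k))) = (\<Sum>k<N. 1)"
      by (intro sum.cong) auto
    then show ?thesis using Suc False by simp
  qed
qed simp

text \<open>
  A normalised positive linear functional on the real continuous functions of a compact metric
  space.  The functional is defined on all functions; only its values on continuous ones matter.
\<close>

locale state_functional =
  fixes L :: "('x::metric_space \<Rightarrow> real) \<Rightarrow> real"
  assumes compact_UNIV: "compact (UNIV :: 'x set)"
    and L_add: "continuous_on UNIV f \<Longrightarrow> continuous_on UNIV g \<Longrightarrow> L (\<lambda>x. f x + g x) = L f + L g"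
    and L_scale: "continuous_on UNIV f \<Longrightarrow> L (\<lambda>x. c * f x) = c * L f"
    and L_nonneg: "continuous_on UNIV f \<Longrightarrow> (\<And>x. 0 \<le> f x) \<Longrightarrow> 0 \<le> L f"
    and L_one: "L (\<lambda>x. 1) = 1"
begin

lemma L_const: "L (\<lambda>x. c) = c"
  using L_scale[of "\<lambda>x. 1" c] L_one by simp

lemma L_diff:
  assumes "continuous_on UNIV f" "continuous_on UNIV g"
  shows "L (\<lambda>x. f x - g x) = L f - L g"
  using L_add[of f "\<lambda>x. (-1) * g x"] L_scale[of g "-1"] assms
  by (auto intro!: continuous_intros)

lemma L_mono:
  assumes "continuous_on UNIV f" "continuous_on UNIV g" "\<And>x. f x \<le> g x"
  shows "L f \<le> L g"
  using L_nonneg[of "\<lambda>x. g x - f x"] L_diff[of g f] assms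
  by (auto intro!: continuous_intros)

lemma L_sum:
  assumes "\<And>i. i < n \<Longrightarrow> continuous_on UNIV (f i)"
  shows "L (\<lambda>x. \<Sum>i<(n::nat). f i x) = (\<Sum>i<n. L (f i))"
  using assms
proof (induction n)
  case (Suc n)
  then have "L (\<lambda>x. (\<Sum>i<n. f i x) + f n x) = L (\<lambda>x. \<Sum>i<n. f i x) + L (f n)"
    by (intro L_add continuous_intros) auto
  then show ?case using Suc by simp
qed (simp add: L_const)

text \<open>
  The continuous functions between \<open>0\<close> and the indicator of \<open>U\<close>.
\<close>

definition minorant :: "'x set \<Rightarrow> ('x \<Rightarrow> real) \<Rightarrow> bool" where
  "minorant U f \<longleftrightarrow> continuous_on UNIV f \<and> (\<forall>x. 0 \<le> f x \<and> f x \<le> indicator U x)"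

text \<open>
  The measure that an open set has to receive, and the outer measure that it generates.
\<close>

definition content :: "'x set \<Rightarrow> ennreal" where
  "content U = (SUP f\<in>Collect (minorant U). ennreal (L f))"

definition outer :: "'x set \<Rightarrow> ennreal" where
  "outer A = (INF U\<in>{U. open U \<and> A \<subseteq> U}. content U)"

lemma minorant_0: "minorant U (\<lambda>x. 0)"
  by (simp add: minorant_def)

lemma minorantD:
  assumes "minorant U f"
  shows "continuous_on UNIV f" "\<And>x. 0 \<le> f x" "\<And>x. f x \<le> 1" "\<And>x. x \<notin> U \<Longrightarrow> f x = 0" "0 \<le> L f"
proof -
  show *: "continuous_on UNIV f" "\<And>x. 0 \<le> f x"
    using assms by (auto simp: minorant_def)
  show "f x \<le> 1" for x
    using assms unfolding minorant_def by (rule conjE) (meson indicator_le_1 order_trans)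
  show "f x = 0" if "x \<notin> U" for x
    using assms that by (auto simp: minorant_def indicator_def intro: antisym dest!: spec[of _ x])
  show "0 \<le> L f"
    using * by (intro L_nonneg)
qed

lemma minorantI:
  assumes "continuous_on UNIV f" "\<And>x. 0 \<le> f x" "\<And>x. f x \<le> 1" "\<And>x. x \<notin> U \<Longrightarrow> f x = 0"
  shows "minorant U f"
  using assms by (auto simp: minorant_def indicator_def)

lemma L_le_content: "minorant U f \<Longrightarrow> ennreal (L f) \<le> content U"
  unfolding content_def by (intro SUP_upper) simp

lemma content_mono: "U \<subseteq> V \<Longrightarrow> content U \<le> content V"
  unfolding content_def
  by (intro SUP_subset_mono) (auto intro!: minorantI dest: minorantD)

lemma content_le_1: "content U \<le> 1"
  unfolding content_def
proof (intro SUP_least)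
  fix f assume "f \<in> Collect (minorant U)"
  then have "L f \<le> L (\<lambda>x. 1)"
    by (intro L_mono) (auto dest: minorantD)
  then show "ennreal (L f) \<le> 1"
    by (simp add: L_one)
qed

lemma content_approx:
  assumes "e > 0"
  obtains f where "minorant U f" "content U \<le> ennreal (L f + e)"
proof -
  have "content U < top"
    using content_le_1[of U] by (rule le_less_trans) simp
  then obtain r where r: "content U = ennreal r" "0 \<le> r"
    by (cases "content U") auto
  show thesis
  proof (cases "r \<le> e")
    case True
    then show thesis
      using r that[OF minorant_0] by (auto simp: L_const ennreal_leI)
  next
    case False
    then have "ennreal (r - e) < content U"
      using r assms by (simp add: ennreal_lessI)
    then obtain f where "minorant U f" "ennreal (r - e) < ennreal (L f)"
      unfolding content_def by (auto simp: less_SUP_iff)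
    then show thesis
      using False r by (intro that[of f]) (auto simp: ennreal_less_iff intro!: ennreal_leI)
  qed
qed

lemma minorant_hat: "open U \<Longrightarrow> minorant U (\<lambda>x. 1 - hat (-U) n x)"
  by (intro minorantI continuous_intros) (auto simp: hat_nonneg hat_le_1 hat_eq_1)

text \<open>
  Countable subadditivity on open sets.  By compactness every minorant of the union lies below
  \<open>e\<close> plus a finite sum of minorants of the \<open>U i\<close>.
\<close>

lemma content_UN:
  fixes U :: "nat \<Rightarrow> 'x set"
  assumes U: "\<And>i. open (U i)"
  shows "content (\<Union>i. U i) \<le> (\<Sum>i. content (U i))"
  unfolding content_def[of "\<Union>i. U i"]
proof (rule SUP_least, rule ennreal_le_epsilon)
  fix f and e :: real assume "f \<in> Collect (minorant (\<Union>i. U i))" "e > 0"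
  then have f: "minorant (\<Union>i. U i) f" by simp
  define h where "h i n x = 1 - hat (- U i) n x" for i n x
  have h: "minorant (U i) (h i n)" for i n
    unfolding h_def by (rule minorant_hat[OF U])
  have h_mono: "h i k x \<le> h i n x" if "k \<le> n" for i k n x
    using hat_antimono[OF that] by (simp add: h_def)
  \<comment> \<open>The open sets V n increase to the whole space, so one of them is the whole space.\<close>
  define V where "V n = {x. f x < e + (\<Sum>i<n. h i n x)}" for n
  have "open (V n)" for n
    unfolding V_def by (intro open_Collect_less continuous_intros minorantD(1)[OF f] minorantD(1)[OF h])
  moreover have V_mono: "V k \<subseteq> V n" if "k \<le> n" for k n
  proof -
    have "(\<Sum>i<k. h i k x) \<le> (\<Sum>i<n. h i n x)" for x
    proof -
      have "(\<Sum>i<k. h i k x) \<le> (\<Sum>i<k. h i n x)"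
        by (intro sum_mono h_mono that)
      also have "\<dots> \<le> (\<Sum>i<n. h i n x)"
        using that by (intro sum_mono2 minorantD(2)[OF h]) auto
      finally show ?thesis .
    qed
    then show ?thesis by (auto simp: V_def intro: less_le_trans)
  qed
  moreover have "UNIV \<subseteq> (\<Union>n. V n)"
  proof
    fix x
    show "x \<in> (\<Union>n. V n)"
    proof (cases "x \<in> (\<Union>i. U i)")
      case False
      then have "x \<in> V 0"
        using minorantD(4)[OF f] \<open>e > 0\<close> by (simp add: V_def)
      then show ?thesis by blast
    next
      case True
      then obtain i where "x \<in> U i" by blast
      then have "\<forall>\<^sub>F n in sequentially. hat (- U i) n x = 0"
        using U by (intro eventually_hat_eq_0) auto
      moreover have "\<forall>\<^sub>F n in sequentially. i < n"
        by (rule eventually_gt_at_top)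
      ultimately have "\<forall>\<^sub>F n in sequentially. x \<in> V n"
      proof eventually_elim
        case (elim n)
        have "f x \<le> h i n x"
          using minorantD(3)[OF f] elim by (simp add: h_def)
        also have "\<dots> \<le> (\<Sum>i<n. h i n x)"
          using elim by (intro member_le_sum minorantD(2)[OF h]) auto
        finally show ?case
          using \<open>e > 0\<close> by (simp add: V_def)
      qed
      then show ?thesis
        by (auto simp: eventually_sequentially)
    qed
  qed
  ultimately obtain D where D: "finite D" "UNIV \<subseteq> (\<Union>n\<in>D. V n)"
    using compactE_image[OF compact_UNIV, of UNIV V] by metis
  define N where "N = Max D"
  have N: "n \<le> N" if "n \<in> D" for n
    using that D(1) by (simp add: N_def)
  have le: "f x \<le> e + (\<Sum>i<N. h i N x)" for x
  proof -
    obtain n where "n \<in> D" "x \<in> V n" using D by blast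
    then have "x \<in> V N" using V_mono[OF N[OF \<open>n \<in> D\<close>]] by blast
    then show ?thesis by (simp add: V_def)
  qed
  have "L f \<le> L (\<lambda>x. e + (\<Sum>i<N. h i N x))"
    by (intro L_mono continuous_intros minorantD(1)[OF f] minorantD(1)[OF h] le)
  also have "\<dots> = L (\<lambda>x. e) + L (\<lambda>x. \<Sum>i<N. h i N x)"
    by (intro L_add continuous_intros minorantD(1)[OF h])
  also have "\<dots> = e + (\<Sum>i<N. L (h i N))"
    by (simp add: L_const L_sum minorantD(1)[OF h])
  finally have "ennreal (L f) \<le> ennreal ((\<Sum>i<N. L (h i N)) + e)"
    by (intro ennreal_leI) simp
  also have "\<dots> = (\<Sum>i<N. ennreal (L (h i N))) + ennreal e"
    using \<open>e > 0\<close> minorantD(5)[OF h] by (simp add: sum_nonneg)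
  also have "\<dots> \<le> (\<Sum>i<N. content (U i)) + ennreal e"
    by (intro add_right_mono sum_mono L_le_content h)
  also have "\<dots> \<le> (\<Sum>i. content (U i)) + ennreal e"
    by (intro add_right_mono sum_le_suminf) auto
  finally show "ennreal (L f) \<le> (\<Sum>i. content (U i)) + ennreal e" .
qed

lemma outer_open: "open U \<Longrightarrow> outer U = content U"
  unfolding outer_def by (intro antisym INF_lower INF_greatest content_mono) auto

lemma outer_mono: "A \<subseteq> B \<Longrightarrow> outer A \<le> outer B"
  unfolding outer_def by (intro INF_superset_mono) auto

lemma outer_empty: "outer {} = 0"
proof -
  have "ennreal (L f) = 0" if "minorant {} f" for f
  proof -
    have "f = (\<lambda>x. 0)" using minorantD(4)[OF that] by auto
    then show ?thesis by (simp add: L_const)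
  qed
  then have "content {} \<le> 0"
    unfolding content_def by (intro SUP_least) simp
  then show ?thesis by (simp add: outer_open)
qed

lemma outer_le_1: "outer A \<le> 1"
  using outer_mono[of A UNIV] content_le_1[of UNIV] by (simp add: outer_open)

lemma outer_UN:
  fixes A :: "nat \<Rightarrow> 'x set"
  shows "outer (\<Union>i. A i) \<le> (\<Sum>i. outer (A i))"
proof (rule ennreal_le_epsilon)
  fix e :: real assume "0 < e"
  have "\<exists>U. open U \<and> A n \<subseteq> U \<and> content U \<le> outer (A n) + ennreal (e * (1/2) ^ Suc n)" for n
  proof -
    have "outer (A n) < top"
      using outer_le_1[of "A n"] by (rule le_less_trans) simp
    then have "outer (A n) < outer (A n) + ennreal (e * (1/2) ^ Suc n)"
      using \<open>0 < e\<close> by simp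
    then show ?thesis
      unfolding outer_def[of "A n"] INF_less_iff by (auto intro: less_imp_le)
  qed
  then obtain U where U: "\<And>n. open (U n)" "\<And>n. A n \<subseteq> U n"
      "\<And>n. content (U n) \<le> outer (A n) + ennreal (e * (1/2) ^ Suc n)"
    by metis
  have "outer (\<Union>i. A i) \<le> outer (\<Union>i. U i)"
    using U by (intro outer_mono) blast
  also have "\<dots> = content (\<Union>i. U i)"
    using U by (intro outer_open) auto
  also have "\<dots> \<le> (\<Sum>i. content (U i))"
    by (intro content_UN U)
  also have "\<dots> \<le> (\<Sum>n. outer (A n) + ennreal (e * (1/2) ^ Suc n))"
    by (intro suminf_le U) auto
  also have "\<dots> = (\<Sum>n. outer (A n)) + (\<Sum>n. ennreal e * ennreal ((1/2) ^ Suc n))"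
    using \<open>0 < e\<close> by (subst suminf_add[symmetric])
      (auto simp del: ennreal_suminf_cmult simp add: ennreal_mult[symmetric])
  also have "\<dots> = (\<Sum>n. outer (A n)) + e"
    unfolding ennreal_suminf_cmult
    by (subst suminf_ennreal_eq[OF zero_le_power power_half_series]) auto
  finally show "outer (\<Union>i. A i) \<le> (\<Sum>i. outer (A i)) + ennreal e" .
qed

lemma outer_measure_space_outer: "outer_measure_space (Pow UNIV) outer"
  unfolding outer_measure_space_def positive_def increasing_def countably_subadditive_def
  using outer_empty outer_mono outer_UN by blast

text \<open>
  The Caratheodory condition for an open set \<open>U\<close>, tested on an open set \<open>V\<close>: a near-optimal minorant
  of \<open>V \<inter> U\<close>, lowered by \<open>d\<close>, and a minorant of the open set \<open>W\<close> where it was below \<open>d\<close> have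
  disjoint supports, and their sum is a minorant of \<open>V\<close>.
\<close>

lemma outer_split_open:
  assumes U: "open U" and V: "open V"
  shows "outer (V \<inter> U) + outer (V - U) \<le> content V"
proof (rule ennreal_le_epsilon)
  fix e :: real assume "e > 0"
  define d where "d = e / 3"
  have "d > 0" using \<open>e > 0\<close> by (simp add: d_def)
  obtain f where f: "minorant (V \<inter> U) f" "content (V \<inter> U) \<le> ennreal (L f + d)"
    using content_approx \<open>d > 0\<close> by blast
  define W where "W = V \<inter> {x. f x < d}"
  have W: "open W" "V - U \<subseteq> W"
    using V \<open>d > 0\<close> minorantD[OF f(1)]
    by (auto simp: W_def intro!: open_Int open_Collect_less continuous_intros)
  obtain g where g: "minorant W g" "content W \<le> ennreal (L g + d)"
    using content_approx \<open>d > 0\<close> by blast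
  have fg: "minorant V (\<lambda>x. max 0 (f x - d) + g x)"
  proof (rule minorantI)
    show "continuous_on UNIV (\<lambda>x. max 0 (f x - d) + g x)"
      by (intro continuous_intros minorantD(1)[OF f(1)] minorantD(1)[OF g(1)])
    show "max 0 (f x - d) + g x \<le> 1" for x
      using minorantD[OF f(1)] minorantD[OF g(1)] \<open>d > 0\<close>
      by (cases "x \<in> W") (force simp: W_def max_def algebra_simps not_le intro: add_increasing2)+
    show "max 0 (f x - d) + g x = 0" if "x \<notin> V" for x
      using minorantD(4)[OF f(1)] minorantD(4)[OF g(1)] that \<open>d > 0\<close> by (simp add: W_def)
  qed (use minorantD[OF g(1)] in auto)
  have "L f - d = L (\<lambda>x. f x - d)"
    using L_diff[OF minorantD(1)[OF f(1)], of "\<lambda>x. d"] by (simp add: L_const)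
  also have "\<dots> \<le> L (\<lambda>x. max 0 (f x - d))"
    by (intro L_mono continuous_intros minorantD(1)[OF f(1)]) auto
  finally have "L f + d + (L g + d) \<le> L (\<lambda>x. max 0 (f x - d)) + L g + e"
    by (simp add: d_def field_simps)
  also have "\<dots> = L (\<lambda>x. max 0 (f x - d) + g x) + e"
    by (subst L_add) (auto intro!: continuous_intros minorantD(1)[OF f(1)] minorantD(1)[OF g(1)])
  finally have *: "L f + d + (L g + d) \<le> L (\<lambda>x. max 0 (f x - d) + g x) + e" .
  have "outer (V \<inter> U) + outer (V - U) \<le> content (V \<inter> U) + content W"
    using outer_mono[OF W(2)] outer_open[OF W(1)] outer_open[OF open_Int[OF V U]]
    by (simp add: add_mono)
  also have "\<dots> \<le> ennreal (L f + d) + ennreal (L g + d)"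
    by (intro add_mono f g)
  also have "\<dots> = ennreal (L f + d + (L g + d))"
    using minorantD(5)[OF f(1)] minorantD(5)[OF g(1)] \<open>d > 0\<close>
    by (intro ennreal_plus[symmetric]) auto
  also have "\<dots> \<le> ennreal (L (\<lambda>x. max 0 (f x - d) + g x) + e)"
    by (intro ennreal_leI *)
  also have "\<dots> = ennreal (L (\<lambda>x. max 0 (f x - d) + g x)) + ennreal e"
    using minorantD(5)[OF fg] \<open>e > 0\<close> by simp
  also have "\<dots> \<le> content V + ennreal e"
    by (intro add_right_mono L_le_content fg)
  finally show "outer (V \<inter> U) + outer (V - U) \<le> content V + ennreal e" .
qed

lemma open_in_lambda_system:
  assumes "open U"
  shows "U \<in> lambda_system UNIV (Pow UNIV) outer"
proof -
  interpret sigma_algebra UNIV "Pow UNIV :: 'x set set"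
    by (rule sigma_algebra_Pow)
  have "outer (A \<inter> U) + outer (A - U) = outer A" for A
  proof (rule antisym)
    show "outer (A \<inter> U) + outer (A - U) \<le> outer A"
      unfolding outer_def[of A]
    proof (rule INF_greatest)
      fix V assume "V \<in> {V. open V \<and> A \<subseteq> V}"
      then have "open V" "A \<subseteq> V" by auto
      then have "outer (A \<inter> U) + outer (A - U) \<le> outer (V \<inter> U) + outer (V - U)"
        by (intro add_mono outer_mono) auto
      also have "\<dots> \<le> content V"
        by (intro outer_split_open \<open>open V\<close> assms)
      finally show "outer (A \<inter> U) + outer (A - U) \<le> content V" .
    qed
    have "subadditive (Pow UNIV) outer"
      using outer_measure_space_outer unfolding outer_measure_space_def
      by (intro countably_subadditive_subadditive) auto
    then have "outer ((A \<inter> U) \<union> (A - U)) \<le> outer (A \<inter> U) + outer (A - U)"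
      by (rule subadditiveD) auto
    then show "outer A \<le> outer (A \<inter> U) + outer (A - U)"
      by (simp add: Int_Diff_Un)
  qed
  then show ?thesis
    unfolding lambda_system_eq by blast
qed

text \<open>
  The Borel measure representing \<open>L\<close>.
\<close>

definition riesz_measure :: "'x measure" where
  "riesz_measure = measure_of UNIV (sets borel) outer"

lemma sets_riesz_measure [simp]: "sets riesz_measure = sets borel"
  using sets.sigma_sets_eq[of borel] by (simp add: riesz_measure_def)

lemma space_riesz_measure [simp]: "space riesz_measure = UNIV"
  by (simp add: riesz_measure_def)

lemma emeasure_riesz_measure:
  assumes "A \<in> sets borel"
  shows "emeasure riesz_measure A = outer A"
proof -
  have ms: "measure_space UNIV (lambda_system UNIV (Pow UNIV) outer) outer"
    by (rule sigma_algebra.caratheodory_lemma[OF sigma_algebra_Pow outer_measure_space_outer])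
  then have "sigma_algebra UNIV (lambda_system UNIV (Pow UNIV) outer)"
    by (simp add: measure_space_def)
  then have "sets borel \<subseteq> lambda_system UNIV (Pow UNIV) outer"
    unfolding sets_borel using open_in_lambda_system
    by (intro sigma_algebra.sigma_sets_subset) auto
  then have "measure_space UNIV (sets borel) outer"
    using sets.sigma_algebra_axioms[of "borel :: 'x measure"]
    by (intro measure_down[OF ms]) simp_all
  then show ?thesis
    using assms
    by (intro emeasure_measure_of[OF riesz_measure_def]) (auto simp: measure_space_def)
qed

lemma prob_space_riesz_measure: "prob_space riesz_measure"
proof
  have "ennreal (L (\<lambda>x. 1)) \<le> content UNIV"
    by (intro L_le_content minorantI) auto
  then show "emeasure riesz_measure (space riesz_measure) = 1"
    using content_le_1[of UNIV] by (auto simp: emeasure_riesz_measure outer_open L_one intro: antisym)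
qed

lemma L_le_measure:
  assumes "minorant U f" "open U"
  shows "L f \<le> measure riesz_measure U"
proof -
  interpret prob_space riesz_measure by (rule prob_space_riesz_measure)
  have "ennreal (L f) \<le> emeasure riesz_measure U"
    using L_le_content[OF assms(1)] assms(2) by (simp add: emeasure_riesz_measure outer_open)
  then show ?thesis
    by (simp add: emeasure_eq_measure)
qed

text \<open>
  Cut \<open>N * f\<close> into the \<open>N\<close> layers \<open>h k\<close> between the heights \<open>k\<close> and \<open>k + 1\<close>.  Each layer is a
  minorant of \<open>U k\<close>, where \<open>N * f\<close> exceeds \<open>k\<close>, and the sum of the indicators of the \<open>U k\<close> is at
  most \<open>N * f + 1\<close>.
\<close>

lemma L_le_integral:
  assumes f: "continuous_on UNIV f" "\<And>x. 0 \<le> f x" "\<And>x. f x \<le> 1"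
  shows "L f \<le> (LINT x|riesz_measure. f x)"
proof (rule field_le_epsilon)
  fix e :: real assume "e > 0"
  interpret prob_space riesz_measure by (rule prob_space_riesz_measure)
  obtain N :: nat where N: "N > 0" "1 / real N < e"
    using \<open>e > 0\<close> by (metis nat_approx_posE zero_less_Suc)
  define h where "h k x = min 1 (max 0 (real N * f x - real k))" for k x
  define U where "U k = {x. real k < real N * f x}" for k
  have h_cont: "continuous_on UNIV (h k)" for k
    unfolding h_def by (intro continuous_intros f)
  have U: "open (U k)" for k
    unfolding U_def by (intro open_Collect_less continuous_intros f)
  have minor: "minorant (U k) (h k)" for k
    by (intro minorantI h_cont) (auto simp: h_def U_def)
  have sum_h: "(\<Sum>k<N. h k x) = real N * f x" for x
    unfolding h_def using f N by (intro sum_clamp) (auto simp: mult_left_le)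
  have f_meas [measurable]: "f \<in> borel_measurable riesz_measure"
    using borel_measurable_continuous_onI[OF f(1)] by (simp add: measurable_cong_sets[OF sets_riesz_measure refl])
  have f_int: "integrable riesz_measure f"
    using f by (intro integrable_const_bound[where B = 1]) auto
  have "real N * L f = L (\<lambda>x. \<Sum>k<N. h k x)"
    using L_scale[OF f(1)] by (simp add: sum_h)
  also have "\<dots> = (\<Sum>k<N. L (h k))"
    by (intro L_sum h_cont)
  also have "\<dots> \<le> (\<Sum>k<N. measure riesz_measure (U k))"
    by (intro sum_mono L_le_measure minor U)
  also have "\<dots> = (LINT x|riesz_measure. (\<Sum>k<N. indicator (U k) x))"
    using U by (subst Bochner_Integration.integral_sum) (auto intro!: integrable_real_indicator simp: emeasure_eq_measure)
  also have "\<dots> \<le> (LINT x|riesz_measure. real N * f x + 1)"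
  proof (rule integral_mono)
    show "integrable riesz_measure (\<lambda>x. \<Sum>k<N. indicator (U k) x :: real)"
      using U by (intro Bochner_Integration.integrable_sum integrable_real_indicator) (auto simp: emeasure_eq_measure)
    show "integrable riesz_measure (\<lambda>x. real N * f x + 1)"
      using f_int by auto
    \<comment> \<open>On \<open>U (Suc k)\<close> the function \<open>h k\<close> equals \<open>1\<close>.\<close>
    show "(\<Sum>k<N. indicator (U k) x) \<le> real N * f x + 1" for x
    proof -
      have "(\<Sum>k<Suc N. indicator (U k) x :: real) = indicator (U 0) x + (\<Sum>k<N. indicator (U (Suc k)) x)"
        by (rule sum.lessThan_Suc_shift)
      also have "\<dots> \<le> 1 + (\<Sum>k<N. h k x)"
        by (intro add_mono sum_mono) (auto simp: indicator_def U_def h_def)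
      finally have "(\<Sum>k<N. indicator (U k) x) + indicator (U N) x \<le> 1 + real N * f x"
        by (simp only: sum_h sum.lessThan_Suc)
      moreover have "0 \<le> (indicator (U N) x :: real)"
        by simp
      ultimately show ?thesis by linarith
    qed
  qed
  also have "\<dots> = real N * (LINT x|riesz_measure. f x) + 1"
    using f_int prob_space by simp
  finally have "L f \<le> (LINT x|riesz_measure. f x) + 1 / real N"
    using N by (simp add: field_simps)
  then show "L f \<le> (LINT x|riesz_measure. f x) + e"
    using N by simp
qed

lemma integrable_continuous:
  fixes f :: "'x \<Rightarrow> real"
  assumes "continuous_on UNIV f"
  shows "integrable riesz_measure f"
proof -
  interpret prob_space riesz_measure by (rule prob_space_riesz_measure)
  have "bounded (range f)"
    using assms compact_UNIV by (intro compact_imp_bounded compact_continuous_image)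
  then obtain B where B: "\<And>x. norm (f x) \<le> B"
    by (auto simp: bounded_iff)
  have "f \<in> borel_measurable riesz_measure"
    using borel_measurable_continuous_onI[OF assms] by (simp add: measurable_cong_sets[OF sets_riesz_measure refl])
  then show ?thesis
    using B by (intro integrable_const_bound[where B = B]) auto
qed

text \<open>
  The inequality \<open>L g \<le> integral of g\<close> extends from functions with values in \<open>[0, 1]\<close> to all continuous
  functions by an affine change; applied to \<open>f\<close> and \<open>- f\<close> it gives equality.
\<close>

theorem integral_riesz_measure:
  assumes f: "continuous_on UNIV f"
  shows "(LINT x|riesz_measure. f x) = L f"
proof -
  interpret prob_space riesz_measure by (rule prob_space_riesz_measure)
  have "bounded (range f)"
    using f compact_UNIV by (intro compact_imp_bounded compact_continuous_image)
  then obtain B where B: "B > 0" "\<And>x. norm (f x) \<le> B"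
    by (auto simp: bounded_pos)
  have le: "L g \<le> (LINT x|riesz_measure. g x)"
    if g: "continuous_on UNIV g" and gB: "\<And>x. norm (g x) \<le> B" for g
  proof -
    define g' where "g' x = 1 / (2 * B) * (g x + B)" for x
    have "L g' \<le> (LINT x|riesz_measure. g' x)"
    proof (rule L_le_integral)
      show "continuous_on UNIV g'"
        unfolding g'_def by (intro continuous_intros g)
      show "0 \<le> g' x" "g' x \<le> 1" for x
        using gB[of x] B(1) by (auto simp: g'_def field_simps abs_le_iff)
    qed
    moreover have "L g' = 1 / (2 * B) * (L g + B)"
      unfolding g'_def using g by (simp add: L_scale L_add L_const continuous_intros del: times_divide_eq_left)
    moreover have "(LINT x|riesz_measure. g' x) = 1 / (2 * B) * ((LINT x|riesz_measure. g x) + B)"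
      unfolding g'_def integral_mult_right_zero
      using integrable_continuous[OF g] prob_space by simp
    ultimately show ?thesis
      using B(1) by (simp add: field_simps)
  qed
  have "L (\<lambda>x. - f x) = - L f"
    using L_scale[OF f, of "-1"] by simp
  then show ?thesis
    using le[OF f B(2)] le[of "\<lambda>x. - f x"] f B(2) by (simp add: continuous_intros)
qed

end

section \<open>Weak compactness of probability measures\<close>

lemma bounded_range_compact:
  fixes f :: "'x::topological_space \<Rightarrow> 'b::metric_space"
  assumes "compact (UNIV :: 'x set)" "continuous_on UNIV f"
  shows "bounded (range f)"
  using assms by (intro compact_imp_bounded compact_continuous_image)

lemma borel_integrable_continuous:
  fixes f :: "'x::metric_space \<Rightarrow> 'b::{banach, second_countable_topology}"
  assumes "finite_measure M" "sets M = sets borel" "continuous_on UNIV f" "bounded (range f)"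
  shows "integrable M f"
proof -
  interpret finite_measure M by fact
  obtain B where B: "\<And>x. norm (f x) \<le> B"
    using assms(4) by (auto simp: bounded_iff)
  have "f \<in> borel_measurable M"
    using borel_measurable_continuous_onI[OF assms(3)] by (simp add: measurable_cong_sets[OF assms(2) refl])
  then show ?thesis
    using B by (intro integrable_const_bound[where B = B]) auto
qed

lemma compact_PiE_UNIV:
  fixes S :: "'i \<Rightarrow> 'b::topological_space set"
  assumes "\<And>i. compact (S i)"
  shows "compact (PiE UNIV S)"
  using assms compactin_PiE[of "\<lambda>_. euclidean" UNIV S]
  by (simp add: euclidean_product_topology)

text \<open>
  Every family of Borel probability measures converges weakly to one along a finer filter \<open>H\<close>.
  Filters take the place of subsequences, so separability of the space of continuous functions plays
  no role: Tychonoff's theorem gives a cluster point of the integration functionals in a product of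
  compact intervals, and the Riesz theorem represents it.
\<close>

lemma weak_compactness:
  fixes \<nu> :: "'i \<Rightarrow> 'x::metric_space measure"
  assumes cpt: "compact (UNIV :: 'x set)"
    and prob: "\<And>i. prob_space (\<nu> i)" "\<And>i. sets (\<nu> i) = sets borel"
    and G: "G \<noteq> bot"
  obtains \<mu> H where "prob_space \<mu>" "sets \<mu> = sets borel" "H \<le> G" "H \<noteq> bot"
    "\<And>f :: 'x \<Rightarrow> real. continuous_on UNIV f \<Longrightarrow> ((\<lambda>i. LINT x|\<nu> i. f x) \<longlongrightarrow> (LINT x|\<mu>. f x)) H"
proof -
  have int: "integrable (\<nu> i) f" if "continuous_on UNIV f" for i and f :: "'x \<Rightarrow> real"
    using that prob bounded_range_compact[OF cpt that]
    by (intro borel_integrable_continuous) (auto simp: prob_space_def)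
  have "\<exists>B. continuous_on UNIV f \<longrightarrow> (\<forall>x. \<bar>f x\<bar> \<le> B)" for f :: "'x \<Rightarrow> real"
    using bounded_range_compact[OF cpt, of f] unfolding bounded_real by auto
  then obtain B where B: "\<And>(f :: 'x \<Rightarrow> real) x. continuous_on UNIV f \<Longrightarrow> \<bar>f x\<bar> \<le> B f"
    by metis
  define a :: "'i \<Rightarrow> ('x \<Rightarrow> real) \<Rightarrow> real"
    where "a i f = (if continuous_on UNIV f then LINT x|\<nu> i. f x else 0)" for i f
  have "a i f \<in> cball 0 (max 0 (B f))" for i f
  proof (cases "continuous_on UNIV f")
    case True
    interpret prob_space "\<nu> i" by (rule prob)
    have "norm (LINT x|\<nu> i. f x) \<le> (LINT x|\<nu> i. norm (f x))"
      by (rule integral_norm_bound)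
    also have "\<dots> \<le> (LINT x|\<nu> i. B f)"
      using int[OF True] B[OF True] by (intro integral_mono) auto
    finally show ?thesis using True by (simp add: a_def prob_space)
  qed (simp add: a_def)
  then have "\<forall>\<^sub>F l in filtermap a G. l \<in> PiE UNIV (\<lambda>f. cball 0 (max 0 (B f)))"
    unfolding eventually_filtermap by (intro always_eventually allI PiE_I) auto
  moreover have "compact (PiE UNIV (\<lambda>f :: 'x \<Rightarrow> real. cball (0::real) (max 0 (B f))))"
    by (intro compact_PiE_UNIV compact_cball)
  moreover have "filtermap a G \<noteq> bot"
    using G by (simp add: filtermap_bot_iff)
  ultimately obtain L where L: "inf (nhds L) (filtermap a G) \<noteq> bot"
    unfolding compact_filter by meson
  \<comment> \<open>Along H the functionals a i converge pointwise to the cluster point L.\<close>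
  define H where "H = inf G (filtercomap a (nhds L))"
  have H: "H \<le> G" "H \<noteq> bot"
  proof -
    show "H \<le> G" by (simp add: H_def)
    show "H \<noteq> bot"
    proof
      assume "H = bot"
      then have "eventually (\<lambda>_. False) H" by simp
      then obtain P Q where PQ: "eventually P G" "eventually Q (nhds L)" "\<And>i. P i \<Longrightarrow> Q (a i) \<Longrightarrow> False"
        unfolding H_def eventually_inf eventually_filtercomap by metis
      have "eventually (\<lambda>l. \<not> Q l) (filtermap a G)"
        unfolding eventually_filtermap using PQ(1) by eventually_elim (use PQ(3) in blast)
      then have "eventually (\<lambda>_. False) (inf (nhds L) (filtermap a G))"
        unfolding eventually_inf using PQ(2) by blast
      then show False using L by (simp add: eventually_False)
    qed
  qed
  have a_L: "filterlim a (nhds L) H"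
    unfolding H_def by (rule filterlim_mono[OF filterlim_filtercomap order_refl]) simp
  have a_lim: "((\<lambda>i. a i f) \<longlongrightarrow> L f) H" for f
  proof (rule topological_tendstoI)
    fix S :: "real set" assume S: "open S" "L f \<in> S"
    have "open ((\<lambda>l. l f) -` S)"
      by (rule open_vimage[OF S(1) continuous_on_product_coordinates])
    from topological_tendstoD[OF a_L this] show "\<forall>\<^sub>F i in H. a i f \<in> S"
      using S(2) by simp
  qed
  have lim: "((\<lambda>i. LINT x|\<nu> i. f x) \<longlongrightarrow> L f) H" if "continuous_on UNIV f" for f
  proof -
    have "(\<lambda>i. a i f) = (\<lambda>i. LINT x|\<nu> i. f x)"
      using that by (simp add: a_def)
    then show ?thesis using a_lim[of f] by simp
  qed
  interpret state_functional L
  proof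
    show "compact (UNIV :: 'x set)" by (rule cpt)
    show "L (\<lambda>x. f x + g x) = L f + L g" if "continuous_on UNIV f" "continuous_on UNIV g" for f g
    proof (rule tendsto_unique[OF H(2)])
      show "((\<lambda>i. LINT x|\<nu> i. f x + g x) \<longlongrightarrow> L (\<lambda>x. f x + g x)) H"
        using that by (intro lim continuous_intros)
      show "((\<lambda>i. LINT x|\<nu> i. f x + g x) \<longlongrightarrow> L f + L g) H"
        using tendsto_add[OF lim[OF that(1)] lim[OF that(2)]] int[OF that(1)] int[OF that(2)]
        by (simp only: Bochner_Integration.integral_add)
    qed
    show "L (\<lambda>x. c * f x) = c * L f" if "continuous_on UNIV f" for f c
    proof (rule tendsto_unique[OF H(2)])
      show "((\<lambda>i. LINT x|\<nu> i. c * f x) \<longlongrightarrow> L (\<lambda>x. c * f x)) H"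
        using that by (intro lim continuous_intros)
      show "((\<lambda>i. LINT x|\<nu> i. c * f x) \<longlongrightarrow> c * L f) H"
        using tendsto_mult_left[OF lim[OF that], of c] by (simp only: integral_mult_right_zero)
    qed
    show "0 \<le> L f" if "continuous_on UNIV f" "\<And>x. 0 \<le> f x" for f
      by (rule tendsto_lowerbound[OF lim[OF that(1)] _ H(2)])
        (intro always_eventually allI Bochner_Integration.integral_nonneg that)
    have one: "(LINT x|\<nu> i. 1) = (1 :: real)" for i
      using prob_space.prob_space[OF prob(1)] by simp
    show "L (\<lambda>x. 1) = 1"
      by (rule tendsto_unique[OF H(2) lim[OF continuous_on_const]]) (simp only: one tendsto_const)
  qed
  show thesis
  proof (rule that[OF prob_space_riesz_measure sets_riesz_measure H])
    show "((\<lambda>i. LINT x|\<nu> i. f x) \<longlongrightarrow> (LINT x|riesz_measure. f x)) H"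
      if "continuous_on UNIV f" for f :: "'x \<Rightarrow> real"
      using lim[OF that] by (simp only: integral_riesz_measure[OF that])
  qed
qed

section \<open>Riemann integrability of continuous functions\<close>

text \<open>
  A finite subcover made disjoint: every point of \<open>S\<close> lies in exactly one of the \<open>E i\<close> with
  \<open>i < N\<close>, and \<open>E i\<close> is contained in \<open>U (q i)\<close>.
\<close>

lemma finite_disjointed_cover:
  fixes U :: "'a::topological_space \<Rightarrow> 'a set"
  assumes "compact S" "\<And>p. p \<in> S \<Longrightarrow> open (U p)" "\<And>p. p \<in> S \<Longrightarrow> p \<in> U p"
  obtains N :: nat and q :: "nat \<Rightarrow> 'a" and E where
    "\<And>i. i < N \<Longrightarrow> q i \<in> S"
    "\<And>i. E i = U (q i) - (\<Union>j<i. U (q j))"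
    "\<And>p. p \<in> S \<Longrightarrow> \<exists>!i. i < N \<and> p \<in> E i"
proof -
  obtain D where D: "finite D" "D \<subseteq> S" "S \<subseteq> (\<Union>p\<in>D. U p)"
  proof (rule compactE_image[OF assms(1), of S U])
    show "S \<subseteq> (\<Union>p\<in>S. U p)" using assms(3) by auto
  qed (use assms(2) in auto)
  obtain xs where xs: "set xs = D" using finite_list[OF D(1)] by blast
  define N where "N = length xs"
  define q where "q i = xs ! i" for i
  define E where "E i = U (q i) - (\<Union>j<i. U (q j))" for i
  show thesis
  proof (rule that[of N q E])
    show "q i \<in> S" if "i < N" for i
      using that D(2) xs by (auto simp: q_def N_def)
    show "\<exists>!i. i < N \<and> p \<in> E i" if "p \<in> S" for p
    proof -
      have ex: "\<exists>i. i < N \<and> p \<in> U (q i)"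
      proof -
        obtain p' where "p' \<in> D" "p \<in> U p'" using D(3) \<open>p \<in> S\<close> by blast
        then show ?thesis using xs by (auto simp: q_def N_def in_set_conv_nth)
      qed
      define i where "i = (LEAST i. i < N \<and> p \<in> U (q i))"
      have "i < N" "p \<in> U (q i)"
        using LeastI_ex[OF ex] by (auto simp: i_def)
      moreover have "p \<notin> U (q j)" if "j < i" for j
        using not_less_Least[of j "\<lambda>i. i < N \<and> p \<in> U (q i)"] that \<open>i < N\<close> by (auto simp: i_def)
      ultimately have "i < N \<and> p \<in> E i"
        by (auto simp: E_def)
      moreover have "j = k" if "p \<in> E j" "p \<in> E k" for j k
        using that by (cases j k rule: linorder_cases) (auto simp: E_def)
      ultimately show ?thesis by (intro ex1I[of _ i]) auto
    qed
  qed (simp add: E_def)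
qed

text \<open>
  The space is cut into finitely many pieces on which \<open>\<phi>\<close> is within \<open>e\<close> of a constant.  The pieces are
  differences of balls whose spheres are null sets: around a given centre, only countably many radii
  are excluded.
\<close>

lemma continuous_riemann_integrable:
  fixes \<phi> :: "'x::metric_space \<Rightarrow> complex"
  assumes cpt: "compact (UNIV :: 'x set)"
    and \<mu>: "finite_measure \<mu>" "sets \<mu> = sets borel"
    and \<phi>: "continuous_on UNIV \<phi>"
  shows "riemann_integrable \<mu> \<phi>"
proof -
  interpret finite_measure \<mu> by fact
  have approx: "\<exists>s. jordan_simple \<mu> s \<and> (\<forall>x. dist (s x) (\<phi> x) < e)" if "e > 0" for e
  proof -
    have "\<exists>r>0. (\<forall>y\<in>ball x r. dist (\<phi> x) (\<phi> y) < e) \<and> emeasure \<mu> (sphere x r) = 0" for x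
    proof -
      obtain d where d: "d > 0" "\<And>y. dist y x < d \<Longrightarrow> dist (\<phi> y) (\<phi> x) < e"
        using \<phi> \<open>e > 0\<close> unfolding continuous_on_iff by (metis UNIV_I)
      have [measurable]: "(\<lambda>y. dist x y) \<in> borel_measurable \<mu>"
        by (subst measurable_cong_sets[OF \<mu>(2) refl]) (intro borel_measurable_continuous_onI continuous_intros)
      let ?D = "distr \<mu> borel (\<lambda>y. dist x y)"
      interpret D: finite_measure ?D
        by (rule finite_measure_distr) simp
      \<comment> \<open>The distribution of the distance from \<open>x\<close> under \<open>\<mu>\<close> has only countably many atoms.\<close>
      have "uncountable {0<..<d}"
        using d(1) by (simp add: uncountable_open_interval)
      then obtain r where r: "r \<in> {0<..<d}" "measure ?D {r} = 0"
        using D.countable_support countable_subset[of "{0<..<d}" "{r. measure ?D {r} \<noteq> 0}"] by blast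
      have "measure ?D {r} = measure \<mu> ((\<lambda>y. dist x y) -` {r} \<inter> space \<mu>)"
        by (rule measure_distr) auto
      also have "(\<lambda>y. dist x y) -` {r} \<inter> space \<mu> = sphere x r"
        using sets_eq_imp_space_eq[OF \<mu>(2)] by (auto simp: sphere_def)
      finally have "emeasure \<mu> (sphere x r) = 0"
        using r by (simp add: emeasure_eq_measure)
      moreover have "\<forall>y\<in>ball x r. dist (\<phi> x) (\<phi> y) < e"
        using d(2) r(1) by (auto simp: dist_commute)
      ultimately show ?thesis using r(1) by auto
    qed
    then obtain r where r: "\<And>x. r x > 0" "\<And>x y. y \<in> ball x (r x) \<Longrightarrow> dist (\<phi> x) (\<phi> y) < e"
        "\<And>x. emeasure \<mu> (sphere x (r x)) = 0"
      by metis
    obtain N :: nat and q and E :: "nat \<Rightarrow> 'x set" where E: "\<And>i. E i = ball (q i) (r (q i)) - (\<Union>j<i. ball (q j) (r (q j)))"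
        "\<And>p. \<exists>!i. i < N \<and> p \<in> E i"
    proof (rule finite_disjointed_cover[OF cpt, of "\<lambda>x. ball x (r x)"])
      show "x \<in> ball x (r x)" for x using r(1) by simp
    qed (use that in auto)
    have frontier_E: "frontier (E i) \<subseteq> (\<Union>j\<le>i. sphere (q j) (r (q j)))" for i
    proof
      fix x assume x: "x \<in> frontier (E i)"
      show "x \<in> (\<Union>j\<le>i. sphere (q j) (r (q j)))"
      proof (rule ccontr)
        assume n: "x \<notin> (\<Union>j\<le>i. sphere (q j) (r (q j)))"
        have "x \<in> closure (E i)" "x \<notin> interior (E i)"
          using x by (auto simp: frontier_def)
        have "E i \<subseteq> cball (q i) (r (q i)) - (\<Union>j<i. ball (q j) (r (q j)))"
          unfolding E(1) using ball_subset_cball by blast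
        moreover have "closed (cball (q i) (r (q i)) - (\<Union>j<i. ball (q j) (r (q j))))"
          by (intro closed_Diff closed_cball open_UN ballI open_ball)
        ultimately have "x \<in> cball (q i) (r (q i)) - (\<Union>j<i. ball (q j) (r (q j)))"
          using \<open>x \<in> closure (E i)\<close> closure_minimal by blast
        then have "x \<in> ball (q i) (r (q i)) - (\<Union>j<i. cball (q j) (r (q j)))"
          using n by (force simp: sphere_def order_le_less)
        moreover have "open (ball (q i) (r (q i)) - (\<Union>j<i. cball (q j) (r (q j))))"
          by (intro open_Diff open_ball closed_UN ballI closed_cball) auto
        moreover have "ball (q i) (r (q i)) - (\<Union>j<i. cball (q j) (r (q j))) \<subseteq> E i"
          unfolding E(1) using ball_subset_cball by blast
        ultimately show False
          using \<open>x \<notin> interior (E i)\<close> interior_maximal by blast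
      qed
    qed
    have "emeasure \<mu> (frontier (E i)) = 0" for i
    proof -
      have closed_sph: "closed (sphere x d)" for x :: 'x and d
      proof -
        have "sphere x d = cball x d - ball x d" by auto
        then show ?thesis by (simp only: closed_Diff[OF closed_cball open_ball])
      qed
      have "(\<Union>j\<le>i. sphere (q j) (r (q j))) \<in> null_sets \<mu>"
        using r(3) \<mu>(2) by (intro null_sets_UN') (simp_all add: null_sets_def closed_sph borel_closed)
      then show ?thesis
        using emeasure_mono[OF frontier_E[of i], of \<mu>] by (auto simp: null_sets_def)
    qed
    moreover have "E i \<in> sets borel" for i
      by (simp add: E(1))
    ultimately have "jordan_simple \<mu> (\<lambda>x. \<Sum>k<N. \<phi> (q k) * indicator (E k) x)"
      unfolding jordan_simple_def
      by (intro exI[of _ N] exI[of _ "\<lambda>k. \<phi> (q k)"] exI[of _ E]) simp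
    moreover have "dist (\<Sum>k<N. \<phi> (q k) * indicator (E k) x) (\<phi> x) < e" for x
    proof -
      from E(2)[of x] obtain i where e: "i < N \<and> x \<in> E i" "\<forall>j. j < N \<and> x \<in> E j \<longrightarrow> j = i"
        by (rule ex1E)
      note i = conjunct1[OF e(1)] conjunct2[OF e(1)] e(2)[THEN spec, THEN mp, OF conjI]
      have "(\<Sum>k<N. \<phi> (q k) * indicator (E k) x) = (\<Sum>k<N. if k = i then \<phi> (q i) else 0)"
      proof (intro sum.cong refl)
        fix k assume "k \<in> {..<N}"
        then show "\<phi> (q k) * indicator (E k) x = (if k = i then \<phi> (q i) else 0)"
          using i(2) i(3)[of k] by (cases "x \<in> E k") auto
      qed
      also have "\<dots> = \<phi> (q i)"
        using i(1) by simp
      finally show ?thesis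
        using i(2) r(2)[of x "q i"] unfolding E(1)[of i] by auto
    qed
    ultimately show ?thesis by (intro exI conjI allI)
  qed
  have "\<forall>n. \<exists>s. jordan_simple \<mu> s \<and> (\<forall>x. dist (s x) (\<phi> x) < inverse (real (Suc n)))"
    by (intro allI approx) simp
  then obtain s where s: "\<And>n. jordan_simple \<mu> (s n)" "\<And>n x. dist (s n x) (\<phi> x) < inverse (real (Suc n))"
    by metis
  have "uniform_limit UNIV s \<phi> sequentially"
  proof (rule uniform_limitI)
    fix e :: real assume "e > 0"
    from order_tendstoD(2)[OF LIMSEQ_inverse_real_of_nat this]
    show "\<forall>\<^sub>F n in sequentially. \<forall>x\<in>UNIV. dist (s n x) (\<phi> x) < e"
      by eventually_elim (use s(2) less_trans in blast)
  qed
  then show ?thesis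
    using s(1) unfolding riemann_integrable_def by (intro exI[of _ s]) simp
qed

section \<open>Empirical measures of orbits along a Folner sequence\<close>

lemma integral_norm_le:
  fixes f :: "'a \<Rightarrow> 'b::{banach, second_countable_topology}"
  assumes "integrable M f" "integrable M g" "\<And>x. x \<in> space M \<Longrightarrow> norm (f x) \<le> g x"
  shows "norm (LINT x|M. f x) \<le> (LINT x|M. g x)"
  by (rule order_trans[OF integral_norm_bound integral_mono]) (use assms in auto)

text \<open>
  A compact metric space with a continuous action of a group that carries a left Haar measure and a
  Folner sequence.
\<close>

locale folner_action =
  fixes m :: "'g::{topological_group_add, t2_space} measure"
    and act :: "'g \<Rightarrow> 'x::metric_space \<Rightarrow> 'x"
    and F :: "nat \<Rightarrow> 'g set"
  assumes haar: "left_haar_measure m"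
    and compact_X: "compact (UNIV :: 'x set)"
    and action: "continuous_action act"
    and folner: "folner_sequence m F"
begin

lemma sets_m [simp, measurable_cong]: "sets m = sets borel"
  using haar unfolding left_haar_measure_def by (elim conjE)

lemma haar_translate: "A \<in> sets borel \<Longrightarrow> emeasure m ((+) g ` A) = emeasure m A"
proof -
  have "\<forall>g. \<forall>A\<in>sets borel. emeasure m ((+) g ` A) = emeasure m A"
    using haar unfolding left_haar_measure_def by (elim conjE)
  then show "A \<in> sets borel \<Longrightarrow> emeasure m ((+) g ` A) = emeasure m A" by blast
qed

lemma haar_compact: "compact K \<Longrightarrow> emeasure m K < \<infinity>"
proof -
  have "\<forall>K. compact K \<longrightarrow> emeasure m K < \<infinity>"
    using haar unfolding left_haar_measure_def by (elim conjE)
  then show "compact K \<Longrightarrow> emeasure m K < \<infinity>" by blast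
qed

lemma space_m [simp]: "space m = UNIV"
  using sets_eq_imp_space_eq[OF sets_m] by simp

lemma compact_F: "compact (F n)"
  using folner by (simp add: folner_sequence_def)

lemma F_borel [measurable]: "F n \<in> sets borel"
  by (intro borel_closed compact_imp_closed compact_F)

lemma emeasure_F: "emeasure m (F n) \<noteq> 0" "emeasure m (F n) \<noteq> \<infinity>"
proof -
  have "0 < emeasure m (F n)"
    using folner unfolding folner_sequence_def by simp
  then show "emeasure m (F n) \<noteq> 0" by simp
  have "emeasure m (F n) < \<infinity>"
    by (intro haar_compact compact_F)
  then show "emeasure m (F n) \<noteq> \<infinity>" by simp
qed

lemma measure_F_pos: "0 < measure m (F n)"
  using emeasure_F[of n] by (simp add: measure_def enn2real_positive_iff less_top zero_less_iff_neq_zero)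

lemma emeasure_F_eq: "emeasure m (F n) = ennreal (measure m (F n))"
  using emeasure_F[of n] by (simp add: emeasure_eq_ennreal_measure)

lemma act_act: "act g (act h x) = act (g + h) x"
  using action by (simp add: continuous_action_def)

lemma continuous_act: "continuous_on UNIV (\<lambda>(g, x). act g x)"
  using action by (simp add: continuous_action_def)

lemma continuous_act_point: "continuous_on UNIV (act g)"
  using continuous_on_compose2[OF continuous_act, of UNIV "\<lambda>x. (g, x)"]
  by (simp add: continuous_on_Pair)

lemma continuous_act_group: "continuous_on UNIV (\<lambda>g. act g x)"
  using continuous_on_compose2[OF continuous_act, of UNIV "\<lambda>g. (g, x)"]
  by (simp add: continuous_on_Pair)

lemma act_borel [measurable]: "act g \<in> borel_measurable borel"
  by (intro borel_measurable_continuous_onI continuous_act_point)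

lemma orbit_borel [measurable]: "(\<lambda>g. act g x) \<in> borel_measurable borel"
  by (intro borel_measurable_continuous_onI continuous_act_group)

lemma translate_borel [measurable]: "(+) h \<in> measurable borel (borel :: 'g measure)"
  by (intro borel_measurable_continuous_onI continuous_intros)

text \<open>
  The distribution of \<open>g \<cdot> x\<close> for \<open>g\<close> chosen uniformly in \<open>F n\<close>.  The ergodic average of \<open>\<phi>\<close> at
  \<open>x\<close> is the integral of \<open>\<phi>\<close> against it.
\<close>

definition orbit_measure :: "nat \<Rightarrow> 'x \<Rightarrow> 'x measure" where
  "orbit_measure n x = distr (uniform_measure m (F n)) borel (\<lambda>g. act g x)"

lemma prob_space_uniform: "prob_space (uniform_measure m (F n))"
  by (intro prob_space_uniform_measure emeasure_F)

lemma prob_space_orbit_measure: "prob_space (orbit_measure n x)"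
  unfolding orbit_measure_def
  by (intro prob_space.prob_space_distr prob_space_uniform) simp

lemma sets_orbit_measure [simp, measurable_cong]: "sets (orbit_measure n x) = sets borel"
  by (simp add: orbit_measure_def)

lemma integral_uniform_F:
  fixes f :: "'g \<Rightarrow> 'b::{banach, second_countable_topology}"
  assumes "f \<in> borel_measurable borel"
  shows "(LINT g|uniform_measure m (F n). f g) =
    (LINT g|m. (indicator (F n) g / measure m (F n)) *\<^sub>R f g)"
proof -
  have "uniform_measure m (F n) = density m (\<lambda>g. ennreal (indicator (F n) g / measure m (F n)))"
    unfolding uniform_measure_def emeasure_F_eq
    using measure_F_pos[of n]
    by (intro arg_cong[where f = "density m"] ext)
      (auto simp: indicator_def divide_ennreal[symmetric] simp del: divide_ennreal)
  then show ?thesis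
    using assms measure_F_pos[of n] by (simp add: integral_density)
qed

lemma integral_orbit_measure:
  fixes \<phi> :: "'x \<Rightarrow> 'b::{banach, second_countable_topology}"
  assumes [measurable]: "\<phi> \<in> borel_measurable borel"
  shows "(LINT y|orbit_measure n x. \<phi> y) = (LINT g|uniform_measure m (F n). \<phi> (act g x))"
  unfolding orbit_measure_def by (rule integral_distr) simp_all

lemma ergodic_average_eq:
  assumes [measurable]: "\<phi> \<in> borel_measurable borel"
  shows "ergodic_average act m F n \<phi> x = (LINT y|orbit_measure n x. \<phi> y)"
proof -
  have "(LINT y|orbit_measure n x. \<phi> y) =
      (LINT g|m. (indicator (F n) g / measure m (F n)) *\<^sub>R \<phi> (act g x))"
    by (simp add: integral_orbit_measure integral_uniform_F)
  also have "\<dots> = (LINT g|m. (1 / complex_of_real (measure m (F n))) * (indicator (F n) g *\<^sub>R \<phi> (act g x)))"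
    by (intro Bochner_Integration.integral_cong) (auto simp: scaleR_conv_of_real)
  also have "\<dots> = (1 / complex_of_real (measure m (F n))) * (LINT g|m. indicator (F n) g *\<^sub>R \<phi> (act g x))"
    by (rule integral_mult_right_zero)
  finally show ?thesis
    by (simp only: ergodic_average_def set_lebesgue_integral_def)
qed

lemma distr_translate: "distr m borel ((+) h) = m"
proof (rule measure_eqI)
  fix A assume "A \<in> sets (distr m borel ((+) h))"
  then have A: "A \<in> sets borel" by simp
  have "(+) h -` A = (+) (-h) ` A"
  proof safe
    fix g assume "h + g \<in> A"
    then show "g \<in> (+) (-h) ` A"
      by (intro image_eqI[of _ _ "h + g"]) (auto simp: add.assoc[symmetric])
  qed (auto simp: add.assoc[symmetric])
  then show "emeasure (distr m borel ((+) h)) A = emeasure m A"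
    using A by (simp add: emeasure_distr haar_translate)
qed simp

lemma folner_translate:
  assumes "0 < e"
  shows "\<forall>\<^sub>F n in sequentially. measure m (sym_diff (F n) ((+) h ` F n)) \<le> e * measure m (F n)"
proof -
  have "\<forall>\<^sub>F n in sequentially. almost_invariant m {h} e (F n)"
    using folner assms by (simp add: folner_sequence_def)
  then show ?thesis
  proof eventually_elim
    case (elim n)
    have "set_product {h} (F n) = (+) h ` F n"
      by (auto simp: set_product_def)
    then have "emeasure m (sym_diff (F n) ((+) h ` F n)) \<le> ennreal (e * measure m (F n))"
      using elim assms by (simp add: almost_invariant_def emeasure_F_eq ennreal_mult)
    then show ?case
      using assms measure_F_pos[of n] unfolding measure_def[of m "sym_diff _ _"]
      by (intro enn2real_leI) auto
  qed
qed

text \<open>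
  Left translation by \<open>h\<close> replaces \<open>F n\<close> by \<open>h F n\<close>, so the two integrals differ only by the
  contribution of the symmetric difference.
\<close>

lemma orbit_measure_asymp_invariant:
  fixes \<phi> :: "'x \<Rightarrow> 'b::{banach, second_countable_topology}"
  assumes \<phi> [measurable]: "\<phi> \<in> borel_measurable borel" and B: "\<And>x. norm (\<phi> x) \<le> B"
    and n: "measure m (sym_diff (F n) ((+) h ` F n)) \<le> e * measure m (F n)"
  shows "norm ((LINT y|orbit_measure n x. \<phi> (act h y)) - (LINT y|orbit_measure n x. \<phi> y)) \<le> e * B"
proof -
  define c where "c = measure m (F n)"
  have c: "c > 0" unfolding c_def by (rule measure_F_pos)
  let ?hF = "(+) h ` F n"
  have hF_cpt: "compact ?hF"
    by (intro compact_continuous_image continuous_intros compact_F)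
  then have hF [measurable]: "?hF \<in> sets borel"
    by (intro borel_closed compact_imp_closed)
  have fin: "emeasure m ?hF < \<infinity>" "emeasure m (F n) < \<infinity>"
    by (intro haar_compact hF_cpt compact_F)+
  have B0: "0 \<le> B" using B[of undefined] norm_ge_zero order_trans by blast
  have int: "integrable m (\<lambda>g. (indicator E g / c) *\<^sub>R \<phi> (act g x))"
    if [measurable]: "E \<in> sets borel" and "emeasure m E < \<infinity>" for E
  proof (rule Bochner_Integration.integrable_bound[where f = "\<lambda>g. (B / c) *\<^sub>R indicator E g :: real"])
    show "integrable m (\<lambda>g. (B / c) *\<^sub>R indicator E g :: real)"
      using that by (intro integrable_scaleR_right integrable_real_indicator) auto
    show "AE g in m. norm ((indicator E g / c) *\<^sub>R \<phi> (act g x)) \<le> norm ((B / c) *\<^sub>R indicator E g :: real)"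
      using B c B0 by (auto simp: indicator_def divide_right_mono)
  qed measurable
  have "(LINT y|orbit_measure n x. \<phi> (act h y)) =
      (LINT g|m. (indicator (F n) g / c) *\<^sub>R \<phi> (act (h + g) x))"
    unfolding c_def by (simp add: integral_orbit_measure integral_uniform_F act_act)
  also have "\<dots> = (LINT g|m. (indicator ?hF (h + g) / c) *\<^sub>R \<phi> (act (h + g) x))"
    by (intro Bochner_Integration.integral_cong) (auto simp: indicator_def)
  also have "\<dots> = (LINT g|distr m borel ((+) h). (indicator ?hF g / c) *\<^sub>R \<phi> (act g x))"
    by (rule integral_distr[symmetric]) simp_all
  finally have "(LINT y|orbit_measure n x. \<phi> (act h y)) = (LINT g|m. (indicator ?hF g / c) *\<^sub>R \<phi> (act g x))"
    by (simp add: distr_translate)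
  moreover have "(LINT y|orbit_measure n x. \<phi> y) = (LINT g|m. (indicator (F n) g / c) *\<^sub>R \<phi> (act g x))"
    unfolding c_def by (simp add: integral_orbit_measure integral_uniform_F)
  ultimately have "(LINT y|orbit_measure n x. \<phi> (act h y)) - (LINT y|orbit_measure n x. \<phi> y) =
      (LINT g|m. (indicator ?hF g / c) *\<^sub>R \<phi> (act g x) - (indicator (F n) g / c) *\<^sub>R \<phi> (act g x))"
    using int[OF hF fin(1)] int[OF F_borel fin(2)] by simp
  also have "norm \<dots> \<le> (LINT g|m. (B / c) * indicator (sym_diff (F n) ?hF) g)"
  proof (rule integral_norm_le)
    have "emeasure m (sym_diff (F n) ?hF) \<le> emeasure m (F n \<union> ?hF)"
      by (intro emeasure_mono) auto
    also have "\<dots> \<le> emeasure m (F n) + emeasure m ?hF"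
      by (intro emeasure_subadditive) auto
    also have "\<dots> < \<infinity>" using fin by simp
    finally show "integrable m (\<lambda>g. (B / c) * indicator (sym_diff (F n) ?hF) g)"
      by (intro integrable_mult_right integrable_real_indicator) auto
    show "integrable m (\<lambda>g. (indicator ?hF g / c) *\<^sub>R \<phi> (act g x) - (indicator (F n) g / c) *\<^sub>R \<phi> (act g x))"
      by (intro Bochner_Integration.integrable_diff int hF F_borel fin)
    show "norm ((indicator ?hF g / c) *\<^sub>R \<phi> (act g x) - (indicator (F n) g / c) *\<^sub>R \<phi> (act g x))
        \<le> (B / c) * indicator (sym_diff (F n) ?hF) g" for g
      using B[of "act g x"] c by (auto simp: indicator_def divide_right_mono)
  qed
  also have "\<dots> = (B / c) * measure m (sym_diff (F n) ?hF)"
    by simp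
  also have "\<dots> \<le> (B / c) * (e * c)"
    using n c B0 by (intro mult_left_mono) (auto simp: c_def)
  finally show ?thesis using c by (simp add: field_simps)
qed

lemma limit_orbit_measure_invariant:
  assumes H: "H \<le> sequentially" "H \<noteq> bot"
    and \<mu>: "prob_space \<mu>" "sets \<mu> = sets borel"
    and lim: "\<And>f :: 'x \<Rightarrow> real. continuous_on UNIV f \<Longrightarrow>
      ((\<lambda>n. LINT y|orbit_measure n (x n). f y) \<longlongrightarrow> (LINT y|\<mu>. f y)) H"
  shows "invariant_probability act \<mu>"
proof -
  interpret prob_space \<mu> by fact
  note [measurable_cong] = \<mu>(2)
  have act_meas: "act h \<in> measurable \<mu> borel" for h
    by measurable
  have "distr \<mu> borel (act h) = \<mu>" for h
  proof (rule borel_measure_eqI_continuous)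
    show "finite_measure (distr \<mu> borel (act h))"
      by (intro finite_measure_distr act_meas)
    fix f :: "'x \<Rightarrow> real" assume f: "continuous_on UNIV f" "bounded (range f)"
    obtain B where B: "\<And>x. norm (f x) \<le> B"
      using f(2) by (auto simp: bounded_iff)
    have B0: "0 \<le> B" using B[of undefined] norm_ge_zero order_trans by blast
    have [measurable]: "f \<in> borel_measurable borel"
      by (intro borel_measurable_continuous_onI f)
    have fh: "continuous_on UNIV (\<lambda>y. f (act h y))"
      by (rule continuous_on_compose2[OF f(1) continuous_act_point]) simp
    define D where "D n = (LINT y|orbit_measure n (x n). f (act h y)) - (LINT y|orbit_measure n (x n). f y)" for n
    have "D \<longlonglongrightarrow> 0"
    proof (rule tendstoI)
      fix e :: real assume "e > 0"
      define e' where "e' = e / (B + 1)"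
      have "e' > 0" using \<open>e > 0\<close> B0 by (simp add: e'_def)
      have less: "e' * B < e"
        using \<open>e > 0\<close> B0 by (simp add: e'_def field_simps)
      show "\<forall>\<^sub>F n in sequentially. dist (D n) 0 < e"
        using folner_translate[OF \<open>e' > 0\<close>, of h]
      proof eventually_elim
        case (elim n)
        have "norm (D n) \<le> e' * B"
          unfolding D_def by (rule orbit_measure_asymp_invariant[OF _ B elim]) measurable
        then show ?case using less by simp
      qed
    qed
    then have "(D \<longlongrightarrow> 0) H"
      using H(1) by (rule tendsto_mono[rotated])
    moreover have "(D \<longlongrightarrow> (LINT y|\<mu>. f (act h y)) - (LINT y|\<mu>. f y)) H"
      unfolding D_def by (intro tendsto_diff lim fh f)
    ultimately have "(LINT y|\<mu>. f (act h y)) = (LINT y|\<mu>. f y)"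
      using tendsto_unique[OF H(2)] by fastforce
    then show "(LINT y|distr \<mu> borel (act h). f y) = (LINT y|\<mu>. f y)"
      by (simp add: integral_distr[OF act_meas])
  qed (use \<mu> finite_measure_axioms in auto)
  then show ?thesis
    using \<mu> by (simp add: invariant_probability_def)
qed

text \<open>
  The Krylov--Bogolyubov argument.  The base points may vary with \<open>n\<close>, which is what makes the
  limits in the uniquely ergodic case uniform.
\<close>

lemma invariant_cluster_point:
  fixes x :: "nat \<Rightarrow> 'x"
  assumes "G \<le> sequentially" "G \<noteq> bot"
  obtains \<mu> H where "invariant_probability act \<mu>" "H \<le> G" "H \<noteq> bot"
    "\<And>f :: 'x \<Rightarrow> real. continuous_on UNIV f \<Longrightarrow>
      ((\<lambda>n. LINT y|orbit_measure n (x n). f y) \<longlongrightarrow> (LINT y|\<mu>. f y)) H"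
proof -
  obtain \<mu> H where *: "prob_space \<mu>" "sets \<mu> = sets borel" "H \<le> G" "H \<noteq> bot"
    "\<And>f :: 'x \<Rightarrow> real. continuous_on UNIV f \<Longrightarrow>
      ((\<lambda>n. LINT y|orbit_measure n (x n). f y) \<longlongrightarrow> (LINT y|\<mu>. f y)) H"
    by (rule weak_compactness[OF compact_X, of "\<lambda>n. orbit_measure n (x n)" G])
      (use assms prob_space_orbit_measure in auto)
  have "invariant_probability act \<mu>"
    by (rule limit_orbit_measure_invariant[of H \<mu> x]) (use * assms in auto)
  then show thesis using * that by blast
qed

end

section \<open>Complex continuous functions and Jordan measurable sets\<close>

lemma apply_bcontfun_borel [measurable]:
  fixes \<phi> :: "'x::topological_space \<Rightarrow>\<^sub>C complex"
  shows "apply_bcontfun \<phi> \<in> borel_measurable borel"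
  by (intro borel_measurable_continuous_onI continuous_on_apply_bcontfun)

lemma apply_sum_bcontfun:
  fixes f :: "'i \<Rightarrow> ('x::topological_space \<Rightarrow>\<^sub>C complex)"
  shows "apply_bcontfun (\<Sum>i\<in>I. f i) x = (\<Sum>i\<in>I. apply_bcontfun (f i) x)"
  by (induction I rule: infinite_finite_induct) simp_all

lemma integrable_bcontfun:
  fixes \<phi> :: "'x::metric_space \<Rightarrow>\<^sub>C complex"
  assumes "prob_space M" "sets M = sets borel"
  shows "integrable M (apply_bcontfun \<phi>)"
  by (rule borel_integrable_continuous[OF prob_space.finite_measure[OF assms(1)] assms(2)
      continuous_on_apply_bcontfun bounded_apply_bcontfun])

lemma norm_integral_diff_le:
  fixes f g :: "'a \<Rightarrow> complex"
  assumes "prob_space M" "integrable M f" "integrable M g"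
    and "AE x in M. norm (f x - g x) \<le> e"
  shows "norm ((LINT x|M. f x) - (LINT x|M. g x)) \<le> e"
proof -
  interpret prob_space M by fact
  have "norm (LINT x|M. f x - g x) \<le> (LINT x|M. norm (f x - g x))"
    by (rule integral_norm_bound)
  also have "\<dots> \<le> (LINT x|M. e)"
    using assms by (intro integral_mono_AE integrable_norm Bochner_Integration.integrable_diff) simp_all
  finally show ?thesis
    using assms(2,3) by (simp add: prob_space)
qed

lemma tendsto_integral_complex:
  fixes \<nu> :: "'i \<Rightarrow> 'x::metric_space measure" and \<phi> :: "'x \<Rightarrow>\<^sub>C complex"
  assumes \<nu>: "\<And>i. prob_space (\<nu> i)" "\<And>i. sets (\<nu> i) = sets borel"
    and \<mu>: "prob_space \<mu>" "sets \<mu> = sets borel"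
    and lim: "\<And>f :: 'x \<Rightarrow> real. continuous_on UNIV f \<Longrightarrow>
      ((\<lambda>i. LINT x|\<nu> i. f x) \<longlongrightarrow> (LINT x|\<mu>. f x)) H"
  shows "((\<lambda>i. LINT x|\<nu> i. apply_bcontfun \<phi> x) \<longlongrightarrow> (LINT x|\<mu>. apply_bcontfun \<phi> x)) H"
proof -
  have "continuous_on UNIV (\<lambda>x. Re (apply_bcontfun \<phi> x))" "continuous_on UNIV (\<lambda>x. Im (apply_bcontfun \<phi> x))"
    by (intro continuous_on_Re continuous_on_Im continuous_on_apply_bcontfun)+
  from lim[OF this(1)] lim[OF this(2)] show ?thesis
    unfolding tendsto_complex_iff
      integral_Re[OF integrable_bcontfun[OF \<nu>], symmetric] integral_Im[OF integrable_bcontfun[OF \<nu>], symmetric]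
      integral_Re[OF integrable_bcontfun[OF \<mu>], symmetric] integral_Im[OF integrable_bcontfun[OF \<mu>], symmetric]
    by (rule conjI)
qed

lemma integrable_complex_indicator:
  assumes "finite_measure M" "A \<in> sets M"
  shows "integrable M (\<lambda>x. c * indicator A x :: complex)"
  using assms
  by (intro integrable_mult_right finite_measure.integrable_const_bound[where B = 1])
    (auto simp: indicator_def)

lemma integral_complex_indicator:
  assumes "A \<in> sets M"
  shows "(LINT x|M. c * indicator A x) = c * complex_of_real (measure M A)"
proof -
  have "(LINT x|M. indicator A x) = (LINT x|M. complex_of_real (indicator A x))"
    by (intro Bochner_Integration.integral_cong) (auto simp: indicator_def)
  also have "\<dots> = complex_of_real (measure M A)"
    using sets.sets_into_space[OF assms] by (simp only: integral_complex_of_real) (simp add: Int_absorb2)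
  finally show ?thesis by (simp only: integral_mult_right_zero)
qed

lemma jordan_simple_borel_bounded:
  assumes "jordan_simple \<mu> s"
  shows "s \<in> borel_measurable borel" "bounded (range s)"
proof -
  obtain N :: nat and a A where A: "\<And>k. k < N \<Longrightarrow> A k \<in> sets borel"
    and s: "s = (\<lambda>x. \<Sum>k<N. a k * indicator (A k) x)"
    using assms unfolding jordan_simple_def by auto
  show "s \<in> borel_measurable borel"
    unfolding s using A by (intro borel_measurable_sum borel_measurable_times borel_measurable_const borel_measurable_indicator) simp
  have "norm (s x) \<le> (\<Sum>k<N. norm (a k))" for x
    unfolding s by (rule order_trans[OF norm_sum]) (intro sum_mono, auto simp: indicator_def)
  then show "bounded (range s)"
    by (intro boundedI) auto
qed

global_interpretation bcontfun_complex: vector_space scale_bcontfun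
  rewrites "module.span scale_bcontfun = cspan"
  by (rule vector_space_scale_bcontfun) (simp add: cspan_def)

section \<open>Averages and coboundaries\<close>

context folner_action
begin

lemma ergodic_average_bcontfun:
  "ergodic_average act m F n (apply_bcontfun \<phi>) x = (LINT y|orbit_measure n x. apply_bcontfun \<phi> y)"
  by (rule ergodic_average_eq) measurable

lemmas integrable_orbit_measure =
  integrable_bcontfun[OF prob_space_orbit_measure sets_orbit_measure]

lemma ergodic_average_add:
  "ergodic_average act m F n (apply_bcontfun (\<phi> + \<psi>)) x =
    ergodic_average act m F n (apply_bcontfun \<phi>) x + ergodic_average act m F n (apply_bcontfun \<psi>) x"
  unfolding ergodic_average_bcontfun by (simp add: integrable_orbit_measure)

lemma ergodic_average_diff:
  "ergodic_average act m F n (apply_bcontfun (\<phi> - \<psi>)) x =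
    ergodic_average act m F n (apply_bcontfun \<phi>) x - ergodic_average act m F n (apply_bcontfun \<psi>) x"
  unfolding ergodic_average_bcontfun by (simp add: integrable_orbit_measure)

lemma ergodic_average_scale:
  "ergodic_average act m F n (apply_bcontfun (scale_bcontfun c \<phi>)) x =
    c * ergodic_average act m F n (apply_bcontfun \<phi>) x"
  unfolding ergodic_average_bcontfun apply_scale_bcontfun by (rule integral_mult_right_zero)

lemma ergodic_average_const:
  "ergodic_average act m F n (apply_bcontfun (const_bcontfun c)) x = c"
  unfolding ergodic_average_bcontfun
  using prob_space.prob_space[OF prob_space_orbit_measure[of n x]] by simp

lemma norm_ergodic_average_le:
  "norm (ergodic_average act m F n (apply_bcontfun \<phi>) x) \<le> norm \<phi>"
proof -
  have "norm ((LINT y|orbit_measure n x. apply_bcontfun \<phi> y) - (LINT y|orbit_measure n x. 0)) \<le> norm \<phi>"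
    by (rule norm_integral_diff_le[OF prob_space_orbit_measure integrable_orbit_measure])
      (simp_all add: norm_bounded)
  then show ?thesis by (simp add: ergodic_average_bcontfun)
qed

lemma averages_coboundary:
  assumes "\<psi> \<in> coboundaries act"
  shows "uniform_limit UNIV (\<lambda>n x. ergodic_average act m F n (apply_bcontfun \<psi>) x) (\<lambda>x. 0) sequentially"
proof (rule uniform_limitI)
  fix e :: real assume "e > 0"
  obtain h \<phi> where \<psi>: "\<psi> = koopman act h \<phi> - \<phi>"
    using assms unfolding coboundaries_def by blast
  define e' where "e' = e / (norm \<phi> + 1)"
  have pos: "0 < norm \<phi> + 1"
    using norm_ge_zero[of \<phi>] by linarith
  then have "e' > 0" using \<open>e > 0\<close> by (simp add: e'_def)
  have less: "e' * norm \<phi> < e"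
    using \<open>e > 0\<close> pos by (simp add: e'_def field_simps)
  show "\<forall>\<^sub>F n in sequentially. \<forall>x\<in>UNIV. dist (ergodic_average act m F n (apply_bcontfun \<psi>) x) 0 < e"
    using folner_translate[OF \<open>e' > 0\<close>, of h]
  proof eventually_elim
    case (elim n)
    have "dist (ergodic_average act m F n (apply_bcontfun \<psi>) x) 0 < e" for x
    proof -
      have "norm ((LINT y|orbit_measure n x. apply_bcontfun \<phi> (act h y)) - (LINT y|orbit_measure n x. apply_bcontfun \<phi> y))
          \<le> e' * norm \<phi>"
        by (rule orbit_measure_asymp_invariant[OF apply_bcontfun_borel norm_bounded elim])
      also have "(LINT y|orbit_measure n x. apply_bcontfun \<phi> (act h y)) =
          (LINT y|orbit_measure n x. apply_bcontfun (koopman act h \<phi>) y)"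
        by (simp only: apply_koopman[OF action])
      finally show ?thesis
        using less unfolding \<psi> ergodic_average_diff by (simp add: ergodic_average_bcontfun)
    qed
    then show ?case by simp
  qed
qed

lemma averages_cspan_coboundaries:
  assumes "\<psi> \<in> cspan (coboundaries act)"
  shows "uniform_limit UNIV (\<lambda>n x. ergodic_average act m F n (apply_bcontfun \<psi>) x) (\<lambda>x. 0) sequentially"
  using assms
proof (induction rule: bcontfun_complex.span_induct_alt)
  case base
  show ?case unfolding ergodic_average_bcontfun by (simp add: uniform_limit_const)
next
  case (step c \<psi> \<phi>)
  have "uniform_limit UNIV (\<lambda>n x. c * ergodic_average act m F n (apply_bcontfun \<psi>) x +
      ergodic_average act m F n (apply_bcontfun \<phi>) x) (\<lambda>x. c * 0 + 0) sequentially"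
    by (intro uniform_limit_add bounded_linear.uniform_limit[OF bounded_linear_mult_right]
        averages_coboundary step)
  then show ?case
    by (simp add: ergodic_average_add ergodic_average_scale del: plus_bcontfun.rep_eq apply_scale_bcontfun)
qed

lemma averages_closure_coboundaries:
  assumes "\<psi> \<in> closure (cspan (coboundaries act))"
  shows "uniform_limit UNIV (\<lambda>n x. ergodic_average act m F n (apply_bcontfun \<psi>) x) (\<lambda>x. 0) sequentially"
proof (rule uniform_limitI)
  fix e :: real assume "e > 0"
  then have "e / 2 > 0" by simp
  then obtain b where b: "b \<in> cspan (coboundaries act)" "dist b \<psi> < e / 2"
    using assms unfolding closure_approachable by blast
  show "\<forall>\<^sub>F n in sequentially. \<forall>x\<in>UNIV. dist (ergodic_average act m F n (apply_bcontfun \<psi>) x) 0 < e"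
    using uniform_limitD[OF averages_cspan_coboundaries[OF b(1)] \<open>e / 2 > 0\<close>]
  proof eventually_elim
    case (elim n)
    have "dist (ergodic_average act m F n (apply_bcontfun \<psi>) x) 0 < e" for x
    proof -
      have "norm (ergodic_average act m F n (apply_bcontfun b) x) < e / 2"
        using elim by simp
      moreover have "norm (ergodic_average act m F n (apply_bcontfun b) x -
          ergodic_average act m F n (apply_bcontfun \<psi>) x) < e / 2"
        using norm_ergodic_average_le[of n "b - \<psi>" x] b(2)
        unfolding ergodic_average_diff dist_norm by (rule le_less_trans)
      ultimately show ?thesis
        using norm_triangle_ineq4[of "ergodic_average act m F n (apply_bcontfun b) x"
            "ergodic_average act m F n (apply_bcontfun b) x - ergodic_average act m F n (apply_bcontfun \<psi>) x"]
        by simp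
    qed
    then show ?case by simp
  qed
qed

text \<open>
  The difference of \<open>\<phi>\<close> and its average is, up to \<open>e\<close> and uniformly in \<open>x\<close>, a finite combination of
  coboundaries: a Riemann sum for the average.  The set \<open>F n\<close> is cut into finitely many Borel pieces
  \<open>E i\<close> on which \<open>g \<mapsto> T\<^sub>g \<phi>\<close> stays within \<open>e\<close> of its value at \<open>q i\<close> in the supremum norm.
\<close>

lemma average_approx_coboundary:
  fixes \<phi> :: "'x \<Rightarrow>\<^sub>C complex"
  assumes "e > 0"
  obtains b where "b \<in> cspan (coboundaries act)"
    "\<And>x. norm (apply_bcontfun \<phi> x - ergodic_average act m F n (apply_bcontfun \<phi>) x - apply_bcontfun b x) \<le> e"
proof -
  define P where "P = uniform_measure m (F n)"
  interpret P: prob_space P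
    unfolding P_def by (rule prob_space_uniform)
  have sets_P [simp, measurable_cong]: "sets P = sets borel"
    by (simp add: P_def)
  have "continuous_on (UNIV \<times> UNIV) (\<lambda>(g, x). apply_bcontfun \<phi> (act g x))"
    using continuous_on_compose2[OF continuous_on_apply_bcontfun[of UNIV \<phi>] continuous_act]
    by (simp add: case_prod_unfold)
  then have "\<exists>U. p \<in> U \<and> open U \<and>
      (\<forall>g\<in>U \<inter> UNIV. \<forall>x\<in>UNIV. dist (case (g, x) of (g, x) \<Rightarrow> apply_bcontfun \<phi> (act g x))
        (case (p, x) of (g, x) \<Rightarrow> apply_bcontfun \<phi> (act g x)) \<le> e)" for p
    by (rule continuous_on_prod_compactE[OF _ compact_X UNIV_I[of p] assms]) blast
  then have "\<forall>p. \<exists>U. p \<in> U \<and> open U \<and>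
      (\<forall>g\<in>U. \<forall>x. dist (apply_bcontfun \<phi> (act g x)) (apply_bcontfun \<phi> (act p x)) \<le> e)"
    by simp
  then obtain U where U: "\<And>p. p \<in> U p" "\<And>p. open (U p)"
    "\<And>p g x. g \<in> U p \<Longrightarrow> dist (apply_bcontfun \<phi> (act g x)) (apply_bcontfun \<phi> (act p x)) \<le> e"
    by metis
  obtain N :: nat and q and E :: "nat \<Rightarrow> 'g set" where E: "\<And>i. E i = U (q i) - (\<Union>j<i. U (q j))"
    "\<And>p. p \<in> F n \<Longrightarrow> \<exists>!i. i < N \<and> p \<in> E i"
  proof (rule finite_disjointed_cover[OF compact_F[of n] U(2,1)])
    fix N :: nat and q and E :: "nat \<Rightarrow> 'g set"
    assume "\<And>i. E i = U (q i) - (\<Union>j<i. U (q j))" "\<And>p. p \<in> F n \<Longrightarrow> \<exists>!i. i < N \<and> p \<in> E i"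
    then show thesis by (rule that)
  qed
  have E_borel [measurable]: "E i \<in> sets borel" for i
    unfolding E(1) using U(2) by (intro sets.Diff sets.finite_UN) auto
  \<comment> \<open>The index on the right is that of the piece containing p.\<close>
  have sum_E: "(\<Sum>i<N. f i * indicator (E i) p) = f (THE i. i < N \<and> p \<in> E i)"
    if p: "p \<in> F n" for p and f :: "nat \<Rightarrow> complex"
  proof -
    define k where "k = (THE i. i < N \<and> p \<in> E i)"
    have k: "k < N" "p \<in> E k"
      using theI'[OF E(2)[OF p]] by (simp_all add: k_def)
    have uniq: "i = k" if "i < N" "p \<in> E i" for i
    proof -
      have "(THE i. i < N \<and> p \<in> E i) = i"
        using that by (intro the1_equality E(2)[OF p] conjI)
      then show ?thesis by (simp only: k_def)
    qed
    have "(\<Sum>i<N. f i * indicator (E i) p) = (\<Sum>i<N. if i = k then f k else 0)"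
    proof (intro sum.cong refl)
      fix i assume "i \<in> {..<N}"
      then show "f i * indicator (E i) p = (if i = k then f k else 0)"
        using k(2) uniq[of i] by (cases "p \<in> E i") auto
    qed
    also have "\<dots> = f k" using k(1) by simp
    finally show ?thesis by (simp only: k_def)
  qed
  have int_sum: "integrable P (\<lambda>p. \<Sum>i<N. f i * indicator (E i) p)" for f :: "nat \<Rightarrow> complex"
    by (intro Bochner_Integration.integrable_sum integrable_complex_indicator P.finite_measure_axioms) simp
  have lint_sum: "(LINT p|P. (\<Sum>i<N. f i * indicator (E i) p)) =
      (\<Sum>i<N. f i * complex_of_real (measure P (E i)))" for f :: "nat \<Rightarrow> complex"
  proof -
    have "integrable P (\<lambda>p. f i * indicator (E i) p)" for i
      by (intro integrable_complex_indicator P.finite_measure_axioms) simp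
    then have "(LINT p|P. (\<Sum>i<N. f i * indicator (E i) p)) = (\<Sum>i<N. LINT p|P. f i * indicator (E i) p)"
      by (intro Bochner_Integration.integral_sum)
    then show ?thesis
      by (simp only: integral_complex_indicator[OF E_borel[folded sets_P]])
  qed
  have AE_F: "AE p in P. p \<in> F n"
    unfolding P_def by (rule AE_uniform_measureI) simp_all
  have "(LINT p|P. (\<Sum>i<N. 1 * indicator (E i) p)) = (LINT p|P. (1 :: complex))"
  proof (rule integral_cong_AE)
    show "AE p in P. (\<Sum>i<N. 1 * indicator (E i) p) = (1 :: complex)"
      using AE_F
    proof eventually_elim
      case (elim p)
      show ?case by (rule sum_E[OF elim, of "\<lambda>_. 1"])
    qed
  qed simp_all
  then have sum_1: "(\<Sum>i<N. complex_of_real (measure P (E i))) = 1"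
    unfolding lint_sum by (simp add: P.prob_space)
  define b where "b = (\<Sum>i<N. scale_bcontfun (- complex_of_real (measure P (E i))) (koopman act (q i) \<phi> - \<phi>))"
  show thesis
  proof (rule that[of b])
    have "koopman act g \<phi> - \<phi> \<in> coboundaries act" for g
      unfolding coboundaries_def by blast
    then show "b \<in> cspan (coboundaries act)"
      unfolding b_def
      by (intro bcontfun_complex.span_sum bcontfun_complex.span_scale bcontfun_complex.span_base)
    fix x
    have "apply_bcontfun b x =
        (\<Sum>i<N. complex_of_real (measure P (E i))) * apply_bcontfun \<phi> x -
        (\<Sum>i<N. apply_bcontfun \<phi> (act (q i) x) * complex_of_real (measure P (E i)))"
      unfolding b_def
      by (simp add: apply_sum_bcontfun apply_koopman[OF action] sum_distrib_right
          sum_distrib_left sum_subtractf algebra_simps)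
    then have b: "apply_bcontfun \<phi> x - apply_bcontfun b x =
        (LINT p|P. (\<Sum>i<N. apply_bcontfun \<phi> (act (q i) x) * indicator (E i) p))"
      unfolding lint_sum sum_1 by simp
    have avg: "ergodic_average act m F n (apply_bcontfun \<phi>) x = (LINT p|P. apply_bcontfun \<phi> (act p x))"
      by (simp add: ergodic_average_bcontfun integral_orbit_measure P_def)
    have "norm ((LINT p|P. (\<Sum>i<N. apply_bcontfun \<phi> (act (q i) x) * indicator (E i) p)) -
        (LINT p|P. apply_bcontfun \<phi> (act p x))) \<le> e"
    proof (rule norm_integral_diff_le[OF P.prob_space_axioms int_sum])
      show "integrable P (\<lambda>p. apply_bcontfun \<phi> (act p x))"
        by (rule P.integrable_const_bound[where B = "norm \<phi>"]) (simp_all add: norm_bounded)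
      show "AE p in P. norm ((\<Sum>i<N. apply_bcontfun \<phi> (act (q i) x) * indicator (E i) p) -
          apply_bcontfun \<phi> (act p x)) \<le> e"
        using AE_F
      proof eventually_elim
        case (elim p)
        define k where "k = (THE i. i < N \<and> p \<in> E i)"
        have "p \<in> E k"
          using theI'[OF E(2)[OF elim]] by (simp add: k_def)
        then have "p \<in> U (q k)" by (simp add: E(1)[of k])
        from U(3)[OF this, of x] show ?case
          unfolding sum_E[OF elim, of "\<lambda>i. apply_bcontfun \<phi> (act (q i) x)"] k_def[symmetric]
          by (simp add: dist_norm norm_minus_commute)
      qed
    qed
    then show "norm (apply_bcontfun \<phi> x - ergodic_average act m F n (apply_bcontfun \<phi>) x - apply_bcontfun b x) \<le> e"
      unfolding b[symmetric] avg by (simp add: algebra_simps)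
  qed
qed

lemma integral_cspan_coboundaries:
  assumes \<mu>: "invariant_probability act \<mu>" and "\<psi> \<in> cspan (coboundaries act)"
  shows "(LINT x|\<mu>. apply_bcontfun \<psi> x) = 0"
  using assms(2)
proof (induction rule: bcontfun_complex.span_induct_alt)
  case base
  show ?case by simp
next
  case (step c \<psi> \<phi>)
  have prob: "prob_space \<mu>" and sets_\<mu>: "sets \<mu> = sets borel" and inv: "distr \<mu> borel (act g) = \<mu>" for g
    using \<mu> unfolding invariant_probability_def by simp_all
  note int = integrable_bcontfun[OF prob sets_\<mu>]
  obtain h \<eta> where \<psi>: "\<psi> = koopman act h \<eta> - \<eta>"
    using step(1) unfolding coboundaries_def by blast
  have "act h \<in> measurable \<mu> borel"
    by (simp add: measurable_cong_sets[OF sets_\<mu> refl])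
  then have "(LINT x|distr \<mu> borel (act h). apply_bcontfun \<eta> x) = (LINT x|\<mu>. apply_bcontfun \<eta> (act h x))"
    by (rule integral_distr) simp
  then have "(LINT x|\<mu>. apply_bcontfun (koopman act h \<eta>) x) = (LINT x|\<mu>. apply_bcontfun \<eta> x)"
    by (simp only: inv apply_koopman[OF action])
  then have "(LINT x|\<mu>. apply_bcontfun \<psi> x) = 0"
    unfolding \<psi> by (simp add: int)
  then show ?case
    using step(2) by (simp add: int)
qed

text \<open>
  The average is a uniform limit of the continuous functions \<open>\<phi> - b k\<close>, with the \<open>b k\<close> from
  \<open>average_approx_coboundary\<close>.
\<close>

lemma continuous_ergodic_average:
  "continuous_on UNIV (\<lambda>x. ergodic_average act m F n (apply_bcontfun \<phi>) x)"
proof -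
  have "\<exists>b. \<forall>x. norm (apply_bcontfun \<phi> x - ergodic_average act m F n (apply_bcontfun \<phi>) x - apply_bcontfun b x)
      \<le> inverse (real (Suc k))" for k
    by (rule average_approx_coboundary[of "inverse (real (Suc k))" \<phi> n]) auto
  then obtain b where b: "\<And>k x. norm (apply_bcontfun \<phi> x - ergodic_average act m F n (apply_bcontfun \<phi>) x -
      apply_bcontfun (b k) x) \<le> inverse (real (Suc k))"
    by metis
  have "uniform_limit UNIV (\<lambda>k x. apply_bcontfun (\<phi> - b k) x)
      (\<lambda>x. ergodic_average act m F n (apply_bcontfun \<phi>) x) sequentially"
  proof (rule uniform_limitI)
    fix e :: real assume "e > 0"
    from order_tendstoD(2)[OF LIMSEQ_inverse_real_of_nat this]
    show "\<forall>\<^sub>F k in sequentially. \<forall>x\<in>UNIV. dist (apply_bcontfun (\<phi> - b k) x)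
        (ergodic_average act m F n (apply_bcontfun \<phi>) x) < e"
    proof eventually_elim
      case (elim k)
      have "dist (apply_bcontfun (\<phi> - b k) x) (ergodic_average act m F n (apply_bcontfun \<phi>) x) < e" for x
        using le_less_trans[OF b[of x k] elim] by (simp add: dist_norm algebra_simps)
      then show ?case by simp
    qed
  qed
  then show ?thesis
    by (rule uniform_limit_theorem[rotated])
      (rule sequentially_bot, intro always_eventually allI continuous_on_apply_bcontfun)
qed

text \<open>
  An invariant measure integrates the average of \<open>\<phi>\<close> to the same value as \<open>\<phi>\<close>, because their
  difference is a uniform limit of combinations of coboundaries.  Approximating by coboundaries
  avoids Fubini's theorem, which is delicate here because the Borel sets of \<open>G \<times> X\<close> may not be
  generated by rectangles.
\<close>

lemma integral_eq_limit_average: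
  assumes \<mu>: "invariant_probability act \<mu>"
    and lim: "\<And>x. (\<lambda>n. ergodic_average act m F n (apply_bcontfun \<phi>) x) \<longlonglongrightarrow> c"
  shows "(LINT x|\<mu>. apply_bcontfun \<phi> x) = c"
proof -
  have prob: "prob_space \<mu>" and sets_\<mu> [measurable_cong]: "sets \<mu> = sets borel"
    using \<mu> unfolding invariant_probability_def by simp_all
  interpret prob_space \<mu> by (rule prob)
  note int = integrable_bcontfun[OF prob sets_\<mu>]
  define A where "A n x = ergodic_average act m F n (apply_bcontfun \<phi>) x" for n x
  have A_meas [measurable]: "A n \<in> borel_measurable borel" for n
    unfolding A_def by (intro borel_measurable_continuous_onI continuous_ergodic_average)
  have A_bound: "norm (A n x) \<le> norm \<phi>" for n x
    unfolding A_def by (rule norm_ergodic_average_le)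
  have A_int: "integrable \<mu> (A n)" for n
    by (rule integrable_const_bound[where B = "norm \<phi>"]) (simp_all add: A_bound)
  have A_eq: "(LINT x|\<mu>. A n x) = (LINT x|\<mu>. apply_bcontfun \<phi> x)" for n
  proof -
    have "norm ((LINT x|\<mu>. apply_bcontfun \<phi> x) - (LINT x|\<mu>. A n x)) \<le> e" if "e > 0" for e
    proof -
      obtain b where b: "b \<in> cspan (coboundaries act)"
        "\<And>x. norm (apply_bcontfun \<phi> x - A n x - apply_bcontfun b x) \<le> e"
        unfolding A_def using average_approx_coboundary[OF \<open>e > 0\<close>] by blast
      have "norm ((LINT x|\<mu>. apply_bcontfun \<phi> x - A n x) - (LINT x|\<mu>. apply_bcontfun b x)) \<le> e"
        by (rule norm_integral_diff_le[OF prob]) (simp_all add: int A_int b)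
      then show ?thesis
        using integral_cspan_coboundaries[OF \<mu> b(1)] by (simp add: int A_int)
    qed
    then have "norm ((LINT x|\<mu>. apply_bcontfun \<phi> x) - (LINT x|\<mu>. A n x)) \<le> 0"
      by (rule field_le_epsilon) simp
    then show ?thesis by simp
  qed
  have "(\<lambda>n. LINT x|\<mu>. A n x) \<longlonglongrightarrow> (LINT x|\<mu>. c)"
    by (rule integral_dominated_convergence[where w = "\<lambda>_. norm \<phi>"])
      (simp_all add: A_bound lim A_def[symmetric] lim[folded A_def])
  then show ?thesis
    using LIMSEQ_unique[OF tendsto_const] by (simp add: A_eq prob_space)
qed

section \<open>The implications between the five conditions\<close>

lemma uniform_limit_direct_sum:
  assumes "\<And>\<phi> :: 'x \<Rightarrow>\<^sub>C complex. averages_converge_uniformly act m F (apply_bcontfun \<phi>)"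
  shows "is_direct_sum (range const_bcontfun) (closure (cspan (coboundaries act)))"
  unfolding is_direct_sum_def
proof
  let ?V = "closure (cspan (coboundaries act))"
  have "\<phi> \<in> {u + v |u v. u \<in> range const_bcontfun \<and> v \<in> ?V}" for \<phi>
  proof -
    obtain c where c: "uniform_limit UNIV (\<lambda>n x. ergodic_average act m F n (apply_bcontfun \<phi>) x) (\<lambda>x. c) sequentially"
      using assms unfolding averages_converge_uniformly_def by blast
    have "\<phi> - const_bcontfun c \<in> ?V"
      unfolding closure_approachable
    proof (intro allI impI)
      fix e :: real assume "e > 0"
      then have e3: "e / 3 > 0" by simp
      obtain n where n: "\<And>x. dist (ergodic_average act m F n (apply_bcontfun \<phi>) x) c < e / 3"
        using eventually_happens[OF uniform_limitD[OF c e3]] by auto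
      obtain b where b: "b \<in> cspan (coboundaries act)"
        "\<And>x. norm (apply_bcontfun \<phi> x - ergodic_average act m F n (apply_bcontfun \<phi>) x - apply_bcontfun b x) \<le> e / 3"
        using average_approx_coboundary[OF e3] by blast
      have "norm (apply_bcontfun (\<phi> - const_bcontfun c - b) x) \<le> 2 * e / 3" for x
        using norm_triangle_ineq[of "apply_bcontfun \<phi> x - ergodic_average act m F n (apply_bcontfun \<phi>) x - apply_bcontfun b x"
            "ergodic_average act m F n (apply_bcontfun \<phi>) x - c"] n[of x] b(2)[of x]
        by (simp add: dist_norm algebra_simps)
      then have "norm (\<phi> - const_bcontfun c - b) \<le> 2 * e / 3"
        by (rule norm_bound)
      then have "dist b (\<phi> - const_bcontfun c) < e"
        using \<open>e > 0\<close> unfolding dist_commute[of b "\<phi> - const_bcontfun c"]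
        unfolding dist_norm by linarith
      then show "\<exists>y\<in>cspan (coboundaries act). dist y (\<phi> - const_bcontfun c) < e"
        using b(1) by blast
    qed
    moreover have "\<phi> = const_bcontfun c + (\<phi> - const_bcontfun c)" by simp
    ultimately show ?thesis by blast
  qed
  then show "{u + v |u v. u \<in> range const_bcontfun \<and> v \<in> ?V} = UNIV"
    by (intro UNIV_eq_I[symmetric] | blast)+
  have "u = 0" if "u \<in> range const_bcontfun" "u \<in> ?V" for u :: "'x \<Rightarrow>\<^sub>C complex"
  proof -
    obtain c where u: "u = const_bcontfun c" using \<open>u \<in> range const_bcontfun\<close> by blast
    from tendsto_uniform_limitI[OF averages_closure_coboundaries[OF \<open>u \<in> ?V\<close>] UNIV_I]
    have "(\<lambda>n::nat. c) \<longlonglongrightarrow> 0"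
      unfolding u ergodic_average_const .
    then have "c = 0" by (simp add: LIMSEQ_const_iff)
    then show ?thesis unfolding u by (intro bcontfun_eqI) simp
  qed
  moreover have "0 \<in> range (const_bcontfun :: complex \<Rightarrow> 'x \<Rightarrow>\<^sub>C complex)"
    by (rule range_eqI[of _ _ 0]) (intro bcontfun_eqI, simp)
  moreover have "0 \<in> ?V"
    using bcontfun_complex.span_zero closure_subset by (rule rev_subsetD)
  ultimately show "range const_bcontfun \<inter> ?V = {0}" by blast
qed

lemma direct_sum_uniform_limit:
  assumes "is_direct_sum (range const_bcontfun) (closure (cspan (coboundaries act)))"
  shows "averages_converge_uniformly act m F (apply_bcontfun \<phi>)"
proof -
  have "\<phi> \<in> {u + v |u v. u \<in> range const_bcontfun \<and> v \<in> closure (cspan (coboundaries act))}"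
    using assms unfolding is_direct_sum_def by simp
  then obtain c v where v: "v \<in> closure (cspan (coboundaries act))" and \<phi>: "\<phi> = const_bcontfun c + v"
    by blast
  have "uniform_limit UNIV (\<lambda>n x. c + ergodic_average act m F n (apply_bcontfun v) x) (\<lambda>x. c + 0) sequentially"
    by (intro uniform_limit_add uniform_limit_const averages_closure_coboundaries v)
  then show ?thesis
    unfolding averages_converge_uniformly_def \<phi> ergodic_average_add ergodic_average_const by auto
qed

lemma pointwise_limit_uniquely_ergodic:
  assumes "\<And>\<phi> :: 'x \<Rightarrow>\<^sub>C complex. averages_converge act m F (apply_bcontfun \<phi>)"
  shows "uniquely_ergodic act"
  unfolding uniquely_ergodic_def
proof (rule ex_ex1I)
  show "\<exists>\<mu>. invariant_probability act \<mu>"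
    by (rule invariant_cluster_point[OF order_refl sequentially_bot, of "\<lambda>_. undefined"]) (rule exI)
  fix \<mu> \<nu> assume inv: "invariant_probability act \<mu>" "invariant_probability act \<nu>"
  then have sp: "prob_space \<mu>" "prob_space \<nu>" "sets \<mu> = sets borel" "sets \<nu> = sets borel"
    unfolding invariant_probability_def by simp_all
  show "\<mu> = \<nu>"
  proof (rule borel_measure_eqI_continuous)
    fix f :: "'x \<Rightarrow> real" assume f: "continuous_on UNIV f"
    define \<phi> where "\<phi> = Bcontfun (\<lambda>x. complex_of_real (f x))"
    have "(\<lambda>x. complex_of_real (f x)) \<in> bcontfun"
      unfolding bcontfun_iff_continuous[OF compact_X] by (intro continuous_on_of_real f)
    then have \<phi>: "apply_bcontfun \<phi> = (\<lambda>x. complex_of_real (f x))"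
      by (simp add: \<phi>_def Bcontfun_inverse)
    obtain c where "\<And>x. (\<lambda>n. ergodic_average act m F n (apply_bcontfun \<phi>) x) \<longlonglongrightarrow> c"
      using assms unfolding averages_converge_def by blast
    from integral_eq_limit_average[OF inv(1) this] integral_eq_limit_average[OF inv(2) this]
    show "(LINT x|\<mu>. f x) = (LINT x|\<nu>. f x)"
      unfolding \<phi> integral_complex_of_real by (metis of_real_eq_iff)
  qed (use sp prob_space.finite_measure in auto)
qed

text \<open>
  If the convergence were not uniform, there would be infinitely many \<open>n\<close> with a point \<open>x n\<close> at which
  the average stays away from the integral.  A limit of the orbit measures at these points would be
  a second invariant measure.
\<close>

lemma uniquely_ergodic_uniform_limit:
  assumes \<mu>: "invariant_probability act \<mu>" and uniq: "\<And>\<nu>. invariant_probability act \<nu> \<Longrightarrow> \<nu> = \<mu>"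
  shows "uniform_limit UNIV (\<lambda>n x. ergodic_average act m F n (apply_bcontfun \<phi>) x)
    (\<lambda>x. LINT y|\<mu>. apply_bcontfun \<phi> y) sequentially"
proof (rule uniform_limitI, rule ccontr)
  let ?c = "LINT y|\<mu>. apply_bcontfun \<phi> y"
  let ?A = "\<lambda>n x. ergodic_average act m F n (apply_bcontfun \<phi>) x"
  fix e :: real
  assume "e > 0" and not: "\<not> (\<forall>\<^sub>F n in sequentially. \<forall>x\<in>UNIV. dist (?A n x) ?c < e)"
  define S where "S = {n. \<exists>x. \<not> dist (?A n x) ?c < e}"
  \<comment> \<open>A filter through the bad indices.\<close>
  define G where "G = inf sequentially (principal S)"
  have "G \<noteq> bot"
  proof
    assume "G = bot"
    then have "eventually (\<lambda>_. False) G" by simp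
    then have "\<forall>\<^sub>F n in sequentially. n \<notin> S"
      unfolding G_def eventually_inf_principal by simp
    then show False using not unfolding S_def by simp
  qed
  have "\<exists>x. n \<in> S \<longrightarrow> \<not> dist (?A n x) ?c < e" for n
    unfolding S_def by simp
  then obtain x where x: "\<And>n. n \<in> S \<Longrightarrow> \<not> dist (?A n (x n)) ?c < e"
    by metis
  obtain \<nu> H where H: "invariant_probability act \<nu>" "H \<le> G" "H \<noteq> bot"
    "\<And>f :: 'x \<Rightarrow> real. continuous_on UNIV f \<Longrightarrow>
      ((\<lambda>n. LINT y|orbit_measure n (x n). f y) \<longlongrightarrow> (LINT y|\<nu>. f y)) H"
    by (rule invariant_cluster_point[of G x]) (use \<open>G \<noteq> bot\<close> in \<open>auto simp: G_def\<close>)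
  have sp: "prob_space \<nu>" "sets \<nu> = sets borel"
    using H(1) unfolding invariant_probability_def by simp_all
  have "((\<lambda>n. ?A n (x n)) \<longlongrightarrow> (LINT y|\<nu>. apply_bcontfun \<phi> y)) H"
    unfolding ergodic_average_bcontfun
    by (rule tendsto_integral_complex[OF prob_space_orbit_measure sets_orbit_measure sp H(4)])
  then have "((\<lambda>n. ?A n (x n)) \<longlongrightarrow> ?c) H"
    using uniq[OF H(1)] by simp
  then have "\<forall>\<^sub>F n in H. dist (?A n (x n)) ?c < e"
    using \<open>e > 0\<close> by (rule tendstoD)
  moreover have "\<forall>\<^sub>F n in H. n \<in> S"
    using H(2) unfolding G_def by (simp add: le_principal)
  ultimately have "\<forall>\<^sub>F n in H. False"
    by eventually_elim (use x in blast)
  then show False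
    using H(3) by (simp add: eventually_False)
qed

text \<open>
  The orbit measures at each point converge weakly to \<open>\<mu>\<close>, hence also on sets with \<open>\<mu>\<close>-null
  frontier; a Riemann integrable function is a uniform limit of combinations of their indicators.
\<close>

lemma uniquely_ergodic_riemann_integrable:
  assumes \<mu>: "invariant_probability act \<mu>" and uniq: "\<And>\<nu>. invariant_probability act \<nu> \<Longrightarrow> \<nu> = \<mu>"
    and \<phi>: "riemann_integrable \<mu> \<phi>"
  shows "averages_converge act m F \<phi>"
proof -
  have sp: "prob_space \<mu>" "sets \<mu> = sets borel"
    using \<mu> unfolding invariant_probability_def by simp_all
  obtain s where s: "\<And>j. jordan_simple \<mu> (s j)" "uniform_limit UNIV s \<phi> sequentially"
    using \<phi> unfolding riemann_integrable_def by blast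
  have avg_lim: "uniform_limit UNIV (\<lambda>n x. ergodic_average act m F n (apply_bcontfun \<psi>) x)
      (\<lambda>x. LINT y|\<mu>. apply_bcontfun \<psi> y) sequentially" for \<psi>
    by (rule uniquely_ergodic_uniform_limit[OF \<mu> uniq])
  note s_borel = jordan_simple_borel_bounded(1)[OF s(1)]
  note s_bounded = jordan_simple_borel_bounded(2)[OF s(1)]
  have \<phi>_borel: "\<phi> \<in> borel_measurable borel"
    by (rule borel_measurable_LIMSEQ_metric[OF s_borel]) (rule tendsto_uniform_limitI[OF s(2) UNIV_I])
  obtain k where k: "\<And>x. dist (s k x) (\<phi> x) < 1"
    using eventually_happens[OF uniform_limitD[OF s(2) zero_less_one]] by auto
  obtain B where B: "\<And>x. norm (s k x) \<le> B"
    using s_bounded[of k] unfolding bounded_iff by auto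
  have \<phi>_bound: "norm (\<phi> x) \<le> B + 1" for x
    using norm_triangle_ineq2[of "\<phi> x" "s k x"] k[of x] B[of x] by (simp add: dist_norm norm_minus_commute)
  have int: "integrable M f" if "prob_space M" "sets M = sets borel" "f \<in> borel_measurable borel" "\<And>x. norm (f x) \<le> C"
    for M and f :: "'x \<Rightarrow> complex" and C
  proof -
    interpret prob_space M by fact
    have "f \<in> borel_measurable M" using that by (simp add: measurable_cong_sets[OF that(2) refl])
    then show ?thesis using that(4) by (intro integrable_const_bound[where B = C]) simp_all
  qed
  have int_\<phi>: "integrable M \<phi>" if "prob_space M" "sets M = sets borel" for M
    by (rule int[OF that \<phi>_borel \<phi>_bound])
  have int_s: "integrable M (s j)" if "prob_space M" "sets M = sets borel" for M j
  proof -
    obtain C where "\<And>x. norm (s j x) \<le> C"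
      using s_bounded[of j] unfolding bounded_iff by auto
    from int[OF that s_borel this] show ?thesis .
  qed
  have "(\<lambda>n. ergodic_average act m F n \<phi> x) \<longlonglongrightarrow> (LINT y|\<mu>. \<phi> y)" for x
  proof -
    have lim: "(\<lambda>n. LINT y|orbit_measure n x. f y) \<longlonglongrightarrow> (LINT y|\<mu>. f y)"
      if f: "continuous_on UNIV f" for f :: "'x \<Rightarrow> real"
    proof -
      define \<psi> where "\<psi> = Bcontfun (\<lambda>x. complex_of_real (f x))"
      have "(\<lambda>x. complex_of_real (f x)) \<in> bcontfun"
        unfolding bcontfun_iff_continuous[OF compact_X] by (intro continuous_on_of_real f)
      then have \<psi>: "apply_bcontfun \<psi> = (\<lambda>x. complex_of_real (f x))"
        by (simp add: \<psi>_def Bcontfun_inverse)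
      show ?thesis
        using tendsto_uniform_limitI[OF avg_lim[of \<psi>] UNIV_I[of x], unfolded ergodic_average_bcontfun]
        unfolding \<psi> integral_complex_of_real tendsto_of_real_iff .
    qed
    have simple: "(\<lambda>n. LINT y|orbit_measure n x. s j y) \<longlonglongrightarrow> (LINT y|\<mu>. s j y)" for j
    proof -
      obtain N :: nat and a A where A: "\<And>k. k < N \<Longrightarrow> A k \<in> sets borel \<and> emeasure \<mu> (frontier (A k)) = 0"
        and sj: "s j = (\<lambda>x. \<Sum>k<N. a k * indicator (A k) x)"
        using s(1)[of j] unfolding jordan_simple_def by blast
      have eq: "(LINT y|M. s j y) = (\<Sum>k<N. a k * complex_of_real (measure M (A k)))"
        if M: "prob_space M" "sets M = sets borel" for M
      proof -
        interpret prob_space M by fact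
        have "integrable M (\<lambda>y. a k * indicator (A k) y)" if "k < N" for k
          using A[OF that] M(2)
          by (intro integrable_complex_indicator finite_measure_axioms) simp
        then have "(LINT y|M. s j y) = (\<Sum>k<N. LINT y|M. a k * indicator (A k) y)"
          unfolding sj by (intro Bochner_Integration.integral_sum) simp
        also have "\<dots> = (\<Sum>k<N. a k * complex_of_real (measure M (A k)))"
          using A M(2) by (intro sum.cong integral_complex_indicator refl) simp
        finally show ?thesis .
      qed
      have "(\<lambda>n. measure (orbit_measure n x) (A k)) \<longlonglongrightarrow> measure \<mu> (A k)" if "k < N" for k
        by (rule portmanteau_null_frontier[OF prob_space_orbit_measure sets_orbit_measure sp lim])
          (use A[OF that] in auto)
      then have "(\<lambda>n. \<Sum>k<N. a k * complex_of_real (measure (orbit_measure n x) (A k))) \<longlonglongrightarrow>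
          (\<Sum>k<N. a k * complex_of_real (measure \<mu> (A k)))"
        by (intro tendsto_sum tendsto_mult_left tendsto_of_real) simp
      then show ?thesis
        by (simp only: eq[OF sp] eq[OF prob_space_orbit_measure sets_orbit_measure])
    qed
    have "(\<lambda>n. LINT y|orbit_measure n x. \<phi> y) \<longlonglongrightarrow> (LINT y|\<mu>. \<phi> y)"
    proof (rule tendstoI)
      fix e :: real assume "e > 0"
      then have e3: "e / 3 > 0" by simp
      obtain j where j: "\<And>y. dist (s j y) (\<phi> y) < e / 3"
        using eventually_happens[OF uniform_limitD[OF s(2) e3]] by auto
      have close: "norm ((LINT y|M. \<phi> y) - (LINT y|M. s j y)) \<le> e / 3"
        if M: "prob_space M" "sets M = sets borel" for M
        by (rule norm_integral_diff_le[OF M(1) int_\<phi>[OF M] int_s[OF M]])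
          (use j in \<open>simp add: dist_norm norm_minus_commute less_imp_le\<close>)
      show "\<forall>\<^sub>F n in sequentially. dist (LINT y|orbit_measure n x. \<phi> y) (LINT y|\<mu>. \<phi> y) < e"
        using tendstoD[OF simple[of j] e3]
      proof eventually_elim
        case (elim n)
        let ?a = "LINT y|orbit_measure n x. \<phi> y" and ?b = "LINT y|orbit_measure n x. s j y"
          and ?c = "LINT y|\<mu>. s j y" and ?d = "LINT y|\<mu>. \<phi> y"
        have "dist ?a ?b \<le> e / 3" "dist ?d ?c \<le> e / 3"
          using close[OF prob_space_orbit_measure sets_orbit_measure, of n x] close[OF sp]
          unfolding dist_norm by simp_all
        then show ?case
          using elim dist_triangle[of ?a ?d ?b] dist_triangle2[of ?b ?d ?c] by linarith
      qed
    qed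
    then show ?thesis by (simp only: ergodic_average_eq[OF \<phi>_borel])
  qed
  then show ?thesis
    unfolding averages_converge_def by blast
qed

end

lemma all_equivalentI:
  assumes "B \<Longrightarrow> C" "C \<Longrightarrow> B" "B \<Longrightarrow> A" "A \<Longrightarrow> D" "D \<Longrightarrow> B" "D \<Longrightarrow> E" "E \<Longrightarrow> A"
  shows "all_equivalent [A, B, C, D, E]"
proof -
  have "A = B" "C = B" "D = B" "E = B"
    using assms by blast+
  then show ?thesis by (simp add: all_equivalent_def)
qed

theorem theorem2p1:
  fixes m :: "'g::{topological_group_add, t2_space} measure"
    and act :: "'g \<Rightarrow> 'x::metric_space \<Rightarrow> 'x"
    and F :: "nat \<Rightarrow> 'g set"
  assumes "locally_compact_space (euclidean :: 'g topology)"
    and "sigma_compact (UNIV :: 'g set)"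
    and "left_haar_measure m"
    and "amenable m"
    and "compact (UNIV :: 'x set)"
    and "continuous_action act"
    and "folner_sequence m F"
  shows "all_equivalent
    [\<forall>\<phi> :: 'x \<Rightarrow>\<^sub>C complex. averages_converge act m F (apply_bcontfun \<phi>),
     \<forall>\<phi> :: 'x \<Rightarrow>\<^sub>C complex. averages_converge_uniformly act m F (apply_bcontfun \<phi>),
     is_direct_sum (range const_bcontfun) (closure (cspan (coboundaries act))),
     uniquely_ergodic act,
     \<exists>\<mu>. invariant_probability act \<mu> \<and>
       (\<forall>\<phi>. riemann_integrable \<mu> \<phi> \<longrightarrow> averages_converge act m F \<phi>)]"
    (is "all_equivalent [?pointwise, ?uniform, ?sum, ?ergodic, ?riemann]")
proof -
  interpret folner_action m act F
    using assms by unfold_locales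
  show ?thesis
  proof (rule all_equivalentI)
    show ?sum if ?uniform
      by (rule uniform_limit_direct_sum) (rule that[THEN spec])
    show ?uniform if ?sum
      by (intro allI direct_sum_uniform_limit that)
    show ?pointwise if ?uniform
    proof
      fix \<phi> :: "'x \<Rightarrow>\<^sub>C complex"
      obtain c where "uniform_limit UNIV (\<lambda>n x. ergodic_average act m F n (apply_bcontfun \<phi>) x) (\<lambda>x. c) sequentially"
        using \<open>?uniform\<close> unfolding averages_converge_uniformly_def by blast
      then show "averages_converge act m F (apply_bcontfun \<phi>)"
        unfolding averages_converge_def by (intro exI[of _ c] allI tendsto_uniform_limitI[OF _ UNIV_I])
    qed
    show ?ergodic if ?pointwise
      by (rule pointwise_limit_uniquely_ergodic) (rule that[THEN spec])
    show ?uniform if ?ergodic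
    proof -
      obtain \<mu> where \<mu>: "invariant_probability act \<mu>" "\<And>\<nu>. invariant_probability act \<nu> \<Longrightarrow> \<nu> = \<mu>"
        using \<open>?ergodic\<close> unfolding uniquely_ergodic_def by blast
      show ?thesis
        unfolding averages_converge_uniformly_def
        by (intro allI exI) (rule uniquely_ergodic_uniform_limit[OF \<mu>])
    qed
    show ?riemann if ?ergodic
    proof -
      obtain \<mu> where \<mu>: "invariant_probability act \<mu>" "\<And>\<nu>. invariant_probability act \<nu> \<Longrightarrow> \<nu> = \<mu>"
        using \<open>?ergodic\<close> unfolding uniquely_ergodic_def by blast
      show ?thesis
        by (intro exI[of _ \<mu>] conjI allI impI \<mu>(1)) (rule uniquely_ergodic_riemann_integrable[OF \<mu>])
    qed
    show ?pointwise if ?riemann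
    proof
      fix \<phi> :: "'x \<Rightarrow>\<^sub>C complex"
      obtain \<mu> where \<mu>: "invariant_probability act \<mu>"
        and conv: "\<And>\<phi>. riemann_integrable \<mu> \<phi> \<Longrightarrow> averages_converge act m F \<phi>"
        using \<open>?riemann\<close> by blast
      have "finite_measure \<mu>" "sets \<mu> = sets borel"
        using \<mu> prob_space.finite_measure unfolding invariant_probability_def by auto
      then show "averages_converge act m F (apply_bcontfun \<phi>)"
        by (intro conv continuous_riemann_integrable compact_X continuous_on_apply_bcontfun)
    qed
  qed
qed

end
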